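(* There exist absolute constants $C,c>0$ such that the following holds. Let $k\ge1$, $0<\varepsilon<1$, let $\Gamma\subseteq\mathbb{F}_2^k$ be a generating set with positive weights $(w_\gamma)_{\gamma\in\Gamma}$, and let $G$ be the weighted Cayley graph on $\mathbb{F}_2^k$ generated by $(\Gamma, w)$. Then there exist a subset $\hat\Gamma\subseteq\Gamma$ with $|\hat\Gamma| \le C\frac{k}{\varepsilon^2}(\log_2(4k/\varepsilon))^{c}$ and positive weights $(\hat w_\gamma)_{\gamma\in\hat\Gamma}$ such that the weighted Cayley graph $\hat G$ on $\mathbb{F}_2^k$ generated by $(\hat\Gamma,\hat w)$ satisfies $$(1-\varepsilon)L_G \preceq L_{\hat G} \preceq (1+\varepsilon)L_G.$$
   Context: The weighted Cayley graph on $\mathbb{F}_2^k$ generated by $(\Gamma,w)$ has vertex set $\mathbb{F}_2^k$ and, for each $\gamma\in\Gamma$ and each vertex $x$, an edge between $x$ and $x+\gamma$ of weight $w_\gamma$; its adjacency matrix is $A_{x,y}=\sum_{\gamma\in\Gamma: x+\gamma=y} w_\gamma$. The Laplacian is $L = D - A$ where $D$ is the diagonal matrix of weighted degrees. $X\preceq Y$ means $Y-X$ is positive semidefinite. *)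

theory Defs
  imports Complex_Main
begin

text \<open>Vectors of F_2^k are represented as boolean lists of length k;
  addition is componentwise exclusive or.\<close>

definition vecs :: "nat \<Rightarrow> bool list set" where
  "vecs k = {x. length x = k}"

definition vadd :: "bool list \<Rightarrow> bool list \<Rightarrow> bool list" where
  "vadd x y = map2 (\<noteq>) x y"

definition vzero :: "nat \<Rightarrow> bool list" where
  "vzero k = replicate k False"

inductive_set span_F2 :: "nat \<Rightarrow> bool list set \<Rightarrow> bool list set"
  for k :: nat and \<Gamma> :: "bool list set" where
  zero: "vzero k \<in> span_F2 k \<Gamma>"
| step: "x \<in> span_F2 k \<Gamma> \<Longrightarrow> g \<in> \<Gamma> \<Longrightarrow> vadd x g \<in> span_F2 k \<Gamma>"

definition generating_set :: "nat \<Rightarrow> bool list set \<Rightarrow> bool" where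
  "generating_set k \<Gamma> \<longleftrightarrow> \<Gamma> \<subseteq> vecs k \<and> span_F2 k \<Gamma> = vecs k"

definition cayley_adj :: "bool list set \<Rightarrow> (bool list \<Rightarrow> real) \<Rightarrow> bool list \<Rightarrow> bool list \<Rightarrow> real" where
  "cayley_adj \<Gamma> w x y = (\<Sum>g\<in>{g\<in>\<Gamma>. vadd x g = y}. w g)"

definition cayley_deg :: "nat \<Rightarrow> bool list set \<Rightarrow> (bool list \<Rightarrow> real) \<Rightarrow> bool list \<Rightarrow> real" where
  "cayley_deg k \<Gamma> w x = (\<Sum>y\<in>vecs k. cayley_adj \<Gamma> w x y)"

definition cayley_laplacian :: "nat \<Rightarrow> bool list set \<Rightarrow> (bool list \<Rightarrow> real) \<Rightarrow> bool list \<Rightarrow> bool list \<Rightarrow> real" where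
  "cayley_laplacian k \<Gamma> w x y =
     (if x = y then cayley_deg k \<Gamma> w x else 0) - cayley_adj \<Gamma> w x y"

definition psd_on :: "nat \<Rightarrow> (bool list \<Rightarrow> bool list \<Rightarrow> real) \<Rightarrow> bool" where
  "psd_on k M \<longleftrightarrow> (\<forall>x\<in>vecs k. \<forall>y\<in>vecs k. M x y = M y x) \<and>
     (\<forall>f :: bool list \<Rightarrow> real. 0 \<le> (\<Sum>x\<in>vecs k. \<Sum>y\<in>vecs k. f x * M x y * f y))"

definition loewner_le :: "nat \<Rightarrow> (bool list \<Rightarrow> bool list \<Rightarrow> real) \<Rightarrow> (bool list \<Rightarrow> bool list \<Rightarrow> real) \<Rightarrow> bool" where
  "loewner_le k X Y \<longleftrightarrow> psd_on k (\<lambda>x y. Y x y - X x y)"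

end

theory Submission
  imports Defs "HOL-Analysis.Function_Topology" "HOL-Analysis.Convex"
begin

text \<open>
  The characters of \<open>F_2^k\<close> diagonalise every Cayley Laplacian, and the eigenvalue at \<open>a\<close> is twice the
  weight of the codeword \<open>{g. \<langle>a, g\<rangle> = 1}\<close>. So the task is to reweight few coordinates of a
  binary linear code so that all codeword weights are kept up to a factor \<open>1 \<plusminus> \<epsilon>\<close>.

  Among all convex combinations \<open>u\<close> of indicator vectors of bases, choose the one maximising
  \<open>\<Sum>e. w e * ln (u e)\<close>, and put \<open>\<kappa> e = w e / u e\<close>. The first-order conditions say that every base
  in the support of the combination has maximal \<open>\<kappa>\<close>-weight; by exchange it then restricts to a
  base of every level set \<open>T = {\<kappa> \<ge> t}\<close>. A codeword restricted to \<open>T\<close> is determined by its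
  trace on such a base, so Jensen's inequality bounds the sum of \<open>exp (- \<tau> u(S))\<close> over the
  nonzero restricted codewords \<open>S\<close> by \<open>(1 + exp (- \<tau>))^k - 1\<close>. This replaces Karger-style
  counting in the union bound for sampling \<open>e\<close> with probability \<open>min 1 (\<rho> u e)\<close>. There
  are at most \<open>k\<close> levels, and \<open>w = \<kappa> u\<close> is a positive combination of the restrictions of
  \<open>u\<close> to them.
\<close>

section \<open>Sampling\<close>

text \<open>Method of conditional expectations, for independent inclusion with probabilities \<open>p e\<close>.\<close>

lemma exists_subset_le_expectation:
  fixes p :: "'a \<Rightarrow> real" and g :: "'i \<Rightarrow> 'a \<Rightarrow> bool \<Rightarrow> real" and a :: "'i \<Rightarrow> real"
  assumes "finite E" and p: "\<And>e. e \<in> E \<Longrightarrow> 0 \<le> p e \<and> p e \<le> 1"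
  shows "\<exists>X\<subseteq>E. (\<Sum>i\<in>I. a i * (\<Prod>e\<in>E. g i e (e \<in> X))) \<le>
    (\<Sum>i\<in>I. a i * (\<Prod>e\<in>E. p e * g i e True + (1 - p e) * g i e False))"
  using assms
proof (induction E arbitrary: a)
  case (insert x E)
  define Q where "Q i = (\<Prod>e\<in>E. p e * g i e True + (1 - p e) * g i e False)" for i
  define F where "F b = (\<Sum>i\<in>I. (a i * g i x b) * Q i)" for b
  have "(\<Sum>i\<in>I. a i * (\<Prod>e\<in>insert x E. p e * g i e True + (1 - p e) * g i e False)) =
      (\<Sum>i\<in>I. p x * ((a i * g i x True) * Q i) + (1 - p x) * ((a i * g i x False) * Q i))"
  proof (rule sum.cong[OF refl])
    fix i
    have "(\<Prod>e\<in>insert x E. p e * g i e True + (1 - p e) * g i e False) =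
        (p x * g i x True + (1 - p x) * g i x False) * Q i"
      unfolding Q_def using insert.hyps by (rule prod.insert)
    then show "a i * (\<Prod>e\<in>insert x E. p e * g i e True + (1 - p e) * g i e False) =
        p x * ((a i * g i x True) * Q i) + (1 - p x) * ((a i * g i x False) * Q i)"
      by (simp only:) (simp add: algebra_simps)
  qed
  also have "\<dots> = p x * F True + (1 - p x) * F False"
    unfolding F_def by (simp only: sum.distrib sum_distrib_left)
  finally have eq: "(\<Sum>i\<in>I. a i * (\<Prod>e\<in>insert x E. p e * g i e True + (1 - p e) * g i e False)) =
      p x * F True + (1 - p x) * F False" .
  have px: "0 \<le> p x" "p x \<le> 1" using insert.prems by auto
  \<comment> \<open>A mean over the two choices for \<open>x\<close> is at least the smaller value.
    Committing to that choice multiplies \<open>a i\<close> by \<open>g i x b\<close>, which is why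
    the induction leaves \<open>a\<close> arbitrary.\<close>
  obtain b where b: "F b \<le> p x * F True + (1 - p x) * F False"
  proof (cases "F True \<le> F False")
    case True
    have "F True = p x * F True + (1 - p x) * F True" by (simp add: algebra_simps)
    also have "\<dots> \<le> p x * F True + (1 - p x) * F False"
      using True px by (intro add_left_mono mult_left_mono) auto
    finally show ?thesis by (rule that)
  next
    case False
    have "F False = p x * F False + (1 - p x) * F False" by (simp add: algebra_simps)
    also have "\<dots> \<le> p x * F True + (1 - p x) * F False"
      using False px by (intro add_right_mono mult_left_mono) auto
    finally show ?thesis by (rule that)
  qed
  obtain X where X: "X \<subseteq> E" "(\<Sum>i\<in>I. (a i * g i x b) * (\<Prod>e\<in>E. g i e (e \<in> X))) \<le> F b"
    using insert.IH[of "\<lambda>i. a i * g i x b"] insert.prems unfolding F_def Q_def by auto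
  define Y where "Y = (if b then insert x X else X)"
  have Y: "x \<in> Y \<longleftrightarrow> b" "\<And>e. e \<in> E \<Longrightarrow> e \<in> Y \<longleftrightarrow> e \<in> X" "Y \<subseteq> insert x E"
    unfolding Y_def using X(1) insert.hyps by auto
  have "(\<Sum>i\<in>I. a i * (\<Prod>e\<in>insert x E. g i e (e \<in> Y))) =
      (\<Sum>i\<in>I. (a i * g i x b) * (\<Prod>e\<in>E. g i e (e \<in> X)))"
  proof (rule sum.cong[OF refl])
    fix i
    have "(\<Prod>e\<in>E. g i e (e \<in> Y)) = (\<Prod>e\<in>E. g i e (e \<in> X))"
      using Y(2) by (intro prod.cong) auto
    then show "a i * (\<Prod>e\<in>insert x E. g i e (e \<in> Y)) = (a i * g i x b) * (\<Prod>e\<in>E. g i e (e \<in> X))"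
      using insert.hyps Y(1) by (simp add: mult.assoc)
  qed
  also have "\<dots> \<le> p x * F True + (1 - p x) * F False" using X(2) b by simp
  finally show ?case unfolding eq using Y(3) by blast
qed auto

section \<open>Chernoff bounds and their derandomisation\<close>

text \<open>For negative \<open>x\<close> put \<open>y = - x\<close>: then
  \<open>(1 + y) * (1 - y + y^2) = 1 + y^3\<close> is at least 1, and \<open>1 + y\<close> is at
  most \<open>exp y\<close>.\<close>

lemma exp_le_quadratic:
  fixes x :: real assumes "\<bar>x\<bar> \<le> 1" shows "exp x \<le> 1 + x + x\<^sup>2"
proof (cases "0 \<le> x")
  case True
  then show ?thesis using exp_bound assms by simp
next
  case False
  define y where "y = - x"
  have y: "0 < y" using False y_def by simp
  have "1 \<le> (1 + y) * (1 - y + y\<^sup>2)"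
  proof -
    have "(1 + y) * (1 - y + y\<^sup>2) = 1 + y ^ 3"
      by (simp add: algebra_simps power2_eq_square power3_eq_cube)
    then show ?thesis using y by simp
  qed
  also have "\<dots> \<le> exp y * (1 - y + y\<^sup>2)"
  proof (intro mult_right_mono)
    have "0 \<le> (1 - y)\<^sup>2 + y" using y by simp
    also have "\<dots> = 1 - y + y\<^sup>2" by (simp add: power2_eq_square algebra_simps)
    finally show "0 \<le> 1 - y + y\<^sup>2" .
  qed simp
  finally have "exp (- y) * 1 \<le> exp (- y) * (exp y * (1 - y + y\<^sup>2))"
    by (intro mult_left_mono) auto
  also have "\<dots> = 1 - y + y\<^sup>2" by (simp add: mult.assoc[symmetric] exp_minus)
  finally have "exp (- y) \<le> 1 - y + y\<^sup>2" by simp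
  then show ?thesis by (simp add: y_def)
qed

text \<open>An element kept with probability \<open>p\<close> gets weight \<open>u / p\<close>.
  Without truncation \<open>\<rho> * (u / p) = 1\<close>, so the variable is Bernoulli and
  \<open>1 + x \<le> exp x\<close> applies; if \<open>p = 1\<close> nothing is random and
  \<open>\<theta> \<le> exp \<theta> - 1\<close> suffices. The Poisson form of the bound multiplies
  well over a set.\<close>

lemma sampling_mgf:
  fixes \<rho> u \<theta> :: real
  assumes "0 < \<rho>" "0 < u" defines "p \<equiv> min 1 (\<rho> * u)"
  shows "p * exp (\<theta> * \<rho> * (u / p)) + (1 - p) \<le> exp (\<rho> * u * (exp \<theta> - 1))"
proof (cases "1 \<le> \<rho> * u")
  case True
  then have "p = 1" by (simp add: p_def)
  have "\<theta> \<le> exp \<theta> - 1" using exp_ge_add_one_self[of \<theta>] by linarith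
  then have "\<rho> * u * \<theta> \<le> \<rho> * u * (exp \<theta> - 1)" using assms by (intro mult_left_mono) auto
  then show ?thesis using \<open>p = 1\<close> by (simp add: mult_ac)
next
  case False
  then have p: "p = \<rho> * u" by (simp add: p_def)
  have "p * exp (\<theta> * \<rho> * (u / p)) + (1 - p) = 1 + \<rho> * u * (exp \<theta> - 1)"
  proof -
    have "\<theta> * \<rho> * (u / p) = \<theta>" using assms(1,2) by (simp add: p)
    then show ?thesis by (simp only: p) (simp add: algebra_simps)
  qed
  also have "\<dots> \<le> exp (\<rho> * u * (exp \<theta> - 1))" by (rule exp_ge_add_one_self)
  finally show ?thesis .
qed

text \<open>A Chernoff and union bound as a single estimator: the sample size costs at most 1/2, and
  the two tails at \<open>S\<close> cost \<open>exp (- \<tau> * sum u S)\<close> each, so less than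
  1/2 over all of \<open>F\<close>. The total is below 1, hence for some \<open>X\<close> so is
  every summand.\<close>

theorem exists_sparse_sample:
  fixes u :: "'a \<Rightarrow> real" and \<epsilon> \<tau> :: real
  assumes fin: "finite E" and u: "\<And>e. e \<in> E \<Longrightarrow> 0 < u e"
    and F: "finite F" "\<And>S. S \<in> F \<Longrightarrow> S \<subseteq> E"
    and eps: "0 < \<epsilon>" "\<epsilon> \<le> 1" and tau: "0 < \<tau>"
    and union: "(\<Sum>S\<in>F. exp (- \<tau> * sum u S)) < 1 / 4"
  obtains X v where "X \<subseteq> E" "\<And>e. e \<in> E \<Longrightarrow> 0 < (v e :: real)"
    "real (card X) \<le> 8 * \<tau> / \<epsilon>\<^sup>2 * sum u E + 1"
    "\<And>S. S \<in> F \<Longrightarrow> \<bar>(\<Sum>e\<in>S \<inter> X. v e * u e) - sum u S\<bar> \<le> \<epsilon> * sum u S"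
proof -
  \<comment> \<open>Chosen so that the Chernoff exponent \<open>\<rho> * \<epsilon>^2 / 4\<close>
    equals \<open>\<tau>\<close>.\<close>
  define \<rho> where "\<rho> = 4 * \<tau> / \<epsilon>\<^sup>2"
  have rho: "0 < \<rho>" using tau eps by (simp add: \<rho>_def)
  define p where "p e = min 1 (\<rho> * u e)" for e
  have p: "0 < p e" "p e \<le> 1" "p e \<le> \<rho> * u e" if "e \<in> E" for e
    using mult_pos_pos[OF rho u[OF that]] by (auto simp: p_def)
  then have p01: "0 \<le> p e \<and> p e \<le> 1" if "e \<in> E" for e
    using that less_imp_le by blast
  define \<theta> where "\<theta> s = (if s then \<epsilon> / 2 else - \<epsilon> / 2)" for s
  \<comment> \<open>The summand \<open>None\<close> of the estimator controls the sample size, and \<open>Some (S, s)\<close> the upper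
    (\<open>s = True\<close>) or lower tail at \<open>S\<close>; each is at least 1 if the corresponding bound fails.\<close>
  define g where "g i e b = (case i of None \<Rightarrow> (if b then 2 else 1)
      | Some (S, s) \<Rightarrow> (if e \<in> S \<and> b then exp (\<theta> s * \<rho> * (u e / p e)) else 1))"
    for i :: "('a set \<times> bool) option" and e b
  \<comment> \<open>For either sign, \<open>\<theta> s + \<epsilon>^2 / 2\<close> is
    \<open>\<theta> s\<close> times the critical ratio, which is \<open>1 + \<epsilon>\<close> for
    the upper and \<open>1 - \<epsilon>\<close> for the lower tail.\<close>
  define a where "a i = (case i of None \<Rightarrow> exp (- \<rho> * sum u E) / 2
      | Some (S, s) \<Rightarrow> exp (- \<rho> * (\<theta> s + \<epsilon>\<^sup>2 / 2) * sum u S))" for i :: "('a set \<times> bool) option"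
  define I where "I = insert None (Some ` (F \<times> (UNIV :: bool set)))"
  have finI: "finite I" using F(1) by (simp add: I_def)
  obtain X where X: "X \<subseteq> E" and le: "(\<Sum>i\<in>I. a i * (\<Prod>e\<in>E. g i e (e \<in> X))) \<le>
      (\<Sum>i\<in>I. a i * (\<Prod>e\<in>E. p e * g i e True + (1 - p e) * g i e False))"
    using exists_subset_le_expectation[where p = p and I = I and a = a and g = g, OF fin p01] by blast
  have finX: "finite X" using X fin finite_subset by blast
  have None_mean: "a None * (\<Prod>e\<in>E. p e * g None e True + (1 - p e) * g None e False) \<le> 1 / 2"
  proof -
    have "(\<Prod>e\<in>E. p e * g None e True + (1 - p e) * g None e False) \<le> (\<Prod>e\<in>E. exp (\<rho> * u e))"
    proof (intro prod_mono conjI)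
      fix e assume e: "e \<in> E"
      show "0 \<le> p e * g None e True + (1 - p e) * g None e False" using p[OF e] by (simp add: g_def)
      have "p e * g None e True + (1 - p e) * g None e False = 1 + p e" by (simp add: g_def)
      also have "\<dots> \<le> 1 + \<rho> * u e" using p[OF e] by simp
      also have "\<dots> \<le> exp (\<rho> * u e)" by (rule exp_ge_add_one_self)
      finally show "p e * g None e True + (1 - p e) * g None e False \<le> exp (\<rho> * u e)" .
    qed
    also have "\<dots> = exp (\<rho> * sum u E)" using fin by (simp add: exp_sum sum_distrib_left)
    finally have "a None * (\<Prod>e\<in>E. p e * g None e True + (1 - p e) * g None e False) \<le>
        exp (- \<rho> * sum u E) / 2 * exp (\<rho> * sum u E)"
      by (simp add: a_def mult_left_mono)
    also have "\<dots> = 1 / 2" by (simp add: exp_minus)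
    finally show ?thesis .
  qed
  have Some_mean: "a (Some (S, s)) * (\<Prod>e\<in>E. p e * g (Some (S, s)) e True + (1 - p e) * g (Some (S, s)) e False)
      \<le> exp (- \<tau> * sum u S)" if S: "S \<in> F" for S s
  proof -
    have th: "\<bar>\<theta> s\<bar> \<le> 1" "(\<theta> s)\<^sup>2 = \<epsilon>\<^sup>2 / 4" using eps by (auto simp: \<theta>_def power2_eq_square)
    have SE: "S \<subseteq> E" using F(2)[OF S] .
    have uS: "0 \<le> sum u S" using SE u by (intro sum_nonneg) (auto intro: less_imp_le)
    have "(\<Prod>e\<in>E. p e * g (Some (S, s)) e True + (1 - p e) * g (Some (S, s)) e False)
        = (\<Prod>e\<in>E. if e \<in> S then p e * exp (\<theta> s * \<rho> * (u e / p e)) + (1 - p e) else 1)"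
      by (intro prod.cong) (auto simp: g_def)
    also have "\<dots> = (\<Prod>e\<in>S. p e * exp (\<theta> s * \<rho> * (u e / p e)) + (1 - p e))"
      using fin SE by (simp add: prod.inter_restrict[symmetric] Int_absorb1)
    also have "\<dots> \<le> (\<Prod>e\<in>S. exp (\<rho> * u e * (exp (\<theta> s) - 1)))"
    proof (intro prod_mono conjI)
      fix e assume "e \<in> S"
      then have e: "e \<in> E" using SE by blast
      show "0 \<le> p e * exp (\<theta> s * \<rho> * (u e / p e)) + (1 - p e)" using p[OF e] by simp
      show "p e * exp (\<theta> s * \<rho> * (u e / p e)) + (1 - p e) \<le> exp (\<rho> * u e * (exp (\<theta> s) - 1))"
        using sampling_mgf[OF rho u[OF e]] by (simp add: p_def)
    qed
    also have "\<dots> = exp (\<rho> * sum u S * (exp (\<theta> s) - 1))"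
      using finite_subset[OF SE fin] by (simp add: exp_sum sum_distrib_left sum_distrib_right)
    also have "\<dots> \<le> exp (\<rho> * sum u S * (\<theta> s + \<epsilon>\<^sup>2 / 4))"
    proof -
      have "exp (\<theta> s) - 1 \<le> \<theta> s + \<epsilon>\<^sup>2 / 4" using exp_le_quadratic[OF th(1)] th(2) by simp
      then show ?thesis using rho uS by (simp add: mult_left_mono)
    qed
    finally have "a (Some (S, s)) * (\<Prod>e\<in>E. p e * g (Some (S, s)) e True + (1 - p e) * g (Some (S, s)) e False)
        \<le> a (Some (S, s)) * exp (\<rho> * sum u S * (\<theta> s + \<epsilon>\<^sup>2 / 4))"
      by (rule mult_left_mono) (simp add: a_def)
    also have "\<dots> = exp (- (\<rho> * \<epsilon>\<^sup>2 / 4) * sum u S)"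
      by (simp add: a_def exp_add[symmetric] algebra_simps)
    also have "\<rho> * \<epsilon>\<^sup>2 / 4 = \<tau>" using eps by (simp add: \<rho>_def)
    finally show ?thesis .
  qed
  have sumI: "(\<Sum>i\<in>I. h i) = h None + (\<Sum>S\<in>F. h (Some (S, True)) + h (Some (S, False)))"
    for h :: "_ \<Rightarrow> real"
  proof -
    have "(\<Sum>i\<in>I. h i) = h None + (\<Sum>i\<in>Some ` (F \<times> UNIV). h i)"
      unfolding I_def using F(1) by (subst sum.insert) auto
    also have "(\<Sum>i\<in>Some ` (F \<times> UNIV). h i) = (\<Sum>x\<in>F \<times> UNIV. h (Some x))"
      by (subst sum.reindex) auto
    also have "\<dots> = (\<Sum>S\<in>F. \<Sum>s\<in>UNIV. h (Some (S, s)))"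
      by (simp add: sum.cartesian_product)
    also have "\<dots> = (\<Sum>S\<in>F. h (Some (S, True)) + h (Some (S, False)))"
      by (simp add: UNIV_bool add.commute)
    finally show ?thesis .
  qed
  have "(\<Sum>i\<in>I. a i * (\<Prod>e\<in>E. p e * g i e True + (1 - p e) * g i e False)) \<le>
      1 / 2 + (\<Sum>S\<in>F. exp (- \<tau> * sum u S) + exp (- \<tau> * sum u S))"
    unfolding sumI by (intro add_mono sum_mono None_mean Some_mean)
  also have "\<dots> < 1" unfolding sum.distrib using union by linarith
  finally have total: "(\<Sum>i\<in>I. a i * (\<Prod>e\<in>E. g i e (e \<in> X))) < 1" using le by simp
  have each: "a i * (\<Prod>e\<in>E. g i e (e \<in> X)) < 1" if "i \<in> I" for i
  proof -
    have "0 \<le> a j * (\<Prod>e\<in>E. g j e (e \<in> X))" for j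
      by (intro mult_nonneg_nonneg prod_nonneg) (auto simp: a_def g_def split: option.split)
    then have "a i * (\<Prod>e\<in>E. g i e (e \<in> X)) \<le> (\<Sum>i\<in>I. a i * (\<Prod>e\<in>E. g i e (e \<in> X)))"
      using that finI by (intro member_le_sum) auto
    then show ?thesis using total by simp
  qed
  have "real (card X) \<le> 8 * \<tau> / \<epsilon>\<^sup>2 * sum u E + 1"
  proof -
    have "(\<Prod>e\<in>E. g None e (e \<in> X)) = (\<Prod>e\<in>E. if e \<in> X then 2 else 1)"
      by (intro prod.cong) (auto simp: g_def)
    also have "\<dots> = 2 ^ card X"
      using fin X by (simp add: prod.inter_restrict[symmetric] Int_absorb1)
    finally have "exp (- \<rho> * sum u E) / 2 * 2 ^ card X < 1"
      using each[of None] by (simp add: I_def a_def)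
    then have "2 ^ card X < 2 * exp (\<rho> * sum u E)" by (simp add: exp_minus field_simps)
    then have "ln (2 ^ card X) < ln (2 * exp (\<rho> * sum u E))" by (subst ln_less_cancel_iff) auto
    then have "real (card X) * ln 2 < ln 2 + \<rho> * sum u E" by (simp add: ln_realpow ln_mult)
    then have "(real (card X) - 1) * ln 2 < \<rho> * sum u E" by (simp add: algebra_simps)
    \<comment> \<open>Replacing \<open>ln 2\<close> by 1/2 turns the factor 4 of
      \<open>\<rho>\<close> into 8. It needs a nonnegative left factor; an empty sample meets the
      size bound outright.\<close>
    moreover have "(real (card X) - 1) * (1 / 2) \<le> (real (card X) - 1) * ln 2" if "1 \<le> real (card X)"
      using that ln_ge_iff[of 2 "1 / 2"] exp_half_le2 by (intro mult_left_mono) auto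
    moreover have "0 \<le> \<rho> * sum u E" using rho u by (intro mult_nonneg_nonneg sum_nonneg) (auto intro: less_imp_le)
    ultimately have "real (card X) \<le> 2 * (\<rho> * sum u E) + 1" by (cases "1 \<le> real (card X)") auto
    then show ?thesis by (simp add: \<rho>_def)
  qed
  \<comment> \<open>The multipliers are inverse inclusion probabilities, so the reweighted mass of
    \<open>S\<close> has mean \<open>sum u S\<close>.\<close>
  moreover have "\<bar>(\<Sum>e\<in>S \<inter> X. 1 / p e * u e) - sum u S\<bar> \<le> \<epsilon> * sum u S" if S: "S \<in> F" for S
  proof -
    define Z where "Z = (\<Sum>e\<in>S \<inter> X. 1 / p e * u e)"
    have SE: "S \<subseteq> E" using F(2)[OF S] .
    have dev: "\<theta> s * Z < (\<theta> s + \<epsilon>\<^sup>2 / 2) * sum u S" for s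
    proof -
      have "(\<Prod>e\<in>E. g (Some (S, s)) e (e \<in> X)) =
          (\<Prod>e\<in>E. if e \<in> S \<inter> X then exp (\<theta> s * \<rho> * (u e / p e)) else 1)"
        by (intro prod.cong) (auto simp: g_def)
      also have "\<dots> = (\<Prod>e\<in>S \<inter> X. exp (\<theta> s * \<rho> * (u e / p e)))"
        using fin SE by (subst prod.inter_restrict[symmetric]) (auto simp: Int_absorb1 intro!: prod.cong)
      also have "\<dots> = exp (\<rho> * (\<theta> s * Z))"
        using finX by (simp add: exp_sum[symmetric] Z_def sum_distrib_left mult_ac)
      finally have "exp (- \<rho> * (\<theta> s + \<epsilon>\<^sup>2 / 2) * sum u S) * exp (\<rho> * (\<theta> s * Z)) < 1"
        using each[of "Some (S, s)"] S by (simp add: I_def a_def)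
      then have "- \<rho> * (\<theta> s + \<epsilon>\<^sup>2 / 2) * sum u S + \<rho> * (\<theta> s * Z) < 0"
        by (metis exp_add exp_less_one_iff)
      then have "\<rho> * (\<theta> s * Z) < \<rho> * ((\<theta> s + \<epsilon>\<^sup>2 / 2) * sum u S)" by (simp add: algebra_simps)
      then show ?thesis using rho by simp
    qed
    have "\<epsilon> / 2 * Z < \<epsilon> / 2 * ((1 + \<epsilon>) * sum u S)"
      using dev[of True] by (simp add: \<theta>_def power2_eq_square algebra_simps)
    then have "Z < (1 + \<epsilon>) * sum u S" using eps by simp
    moreover have "\<epsilon> / 2 * ((1 - \<epsilon>) * sum u S) < \<epsilon> / 2 * Z"
      using dev[of False] by (simp add: \<theta>_def power2_eq_square algebra_simps)
    then have "(1 - \<epsilon>) * sum u S < Z" using eps by simp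
    ultimately show ?thesis unfolding Z_def[symmetric] by (simp add: abs_le_iff algebra_simps)
  qed
  ultimately show ?thesis using that[of X "\<lambda>e. 1 / p e"] X p(1) by simp
qed

text \<open>A nonnegative \<open>\<kappa>\<close> is a nonnegative combination of indicators of its
  superlevel sets. Subtracting the minimum \<open>m\<close> splits off \<open>m * sum y S\<close>
  and removes the minimisers, so induction on the size applies. This carries estimates for
  \<open>u\<close> on all levels over to \<open>w = \<kappa> u\<close>.\<close>

lemma layer_cake_nonneg:
  fixes \<kappa> y :: "'a \<Rightarrow> real"
  assumes "finite S" "\<And>e. e \<in> S \<Longrightarrow> 0 \<le> \<kappa> e"
    and "\<And>t. t \<in> \<kappa> ` S \<Longrightarrow> 0 \<le> sum y {e \<in> S. t \<le> \<kappa> e}"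
  shows "0 \<le> (\<Sum>e\<in>S. \<kappa> e * y e)"
  using assms
proof (induction "card S" arbitrary: S \<kappa> rule: less_induct)
  case less
  show ?case
  proof (cases "S = {}")
    case False
    define m where "m = Min (\<kappa> ` S)"
    have m: "m \<in> \<kappa> ` S" "\<And>e. e \<in> S \<Longrightarrow> m \<le> \<kappa> e" using less.prems(1) False by (auto simp: m_def)
    define R where "R = {e \<in> S. m < \<kappa> e}"
    have "R \<subset> S" using m by (auto simp: R_def)
    then have "card R < card S" using less.prems(1) by (simp add: psubset_card_mono)
    moreover have "finite R" using less.prems(1) by (simp add: R_def)
    moreover have "0 \<le> sum y {e \<in> R. t \<le> \<kappa> e - m}" if "t \<in> (\<lambda>e. \<kappa> e - m) ` R" for t
    proof -
      \<comment> \<open>Here \<open>t > 0\<close>, so \<open>t \<le> \<kappa> e - m\<close> already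
        forces an element of \<open>S\<close> into \<open>R\<close>.\<close>
      have "{e \<in> R. t \<le> \<kappa> e - m} = {e \<in> S. t + m \<le> \<kappa> e}" using that by (auto simp: R_def)
      moreover have "t + m \<in> \<kappa> ` S" using that by (auto simp: R_def)
      ultimately show ?thesis using less.prems(3) by metis
    qed
    ultimately have "0 \<le> (\<Sum>e\<in>R. (\<kappa> e - m) * y e)"
      by (intro less.hyps) (auto simp: R_def)
    also have "\<dots> = (\<Sum>e\<in>S. (\<kappa> e - m) * y e)"
      using less.prems(1) m(2) by (intro sum.mono_neutral_left) (force simp: R_def)+
    also have "\<dots> = (\<Sum>e\<in>S. \<kappa> e * y e) - m * sum y S"
      by (simp add: left_diff_distrib sum_subtractf sum_distrib_left)
    finally have "m * sum y S \<le> (\<Sum>e\<in>S. \<kappa> e * y e)" by simp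
    moreover have "0 \<le> m" using m(1) less.prems(2) by auto
    moreover have "{e \<in> S. m \<le> \<kappa> e} = S" using m(2) by blast
    then have "0 \<le> sum y S" using less.prems(3)[OF m(1)] by simp
    ultimately show ?thesis using mult_nonneg_nonneg[of m "sum y S"] by linarith
  qed simp
qed

section \<open>Bases of a binary code\<close>

text \<open>Codewords are represented by their supports; addition over F_2 is then
  \<open>sym_diff\<close>, and the axioms describe a linear subspace.\<close>

locale binary_code =
  fixes E :: "'a set" and C :: "'a set set"
  assumes finite_E: "finite E"
    and code_subset: "c \<in> C \<Longrightarrow> c \<subseteq> E"
    and empty_code: "{} \<in> C"
    and sym_diff_code: "c \<in> C \<Longrightarrow> d \<in> C \<Longrightarrow> sym_diff c d \<in> C"
begin

text \<open>By linearity a trivial kernel means that a codeword is determined by its trace on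
  \<open>B\<close>. These are the spanning sets of the matroid of columns of a generator
  matrix.\<close>

definition info_set :: "'a set \<Rightarrow> bool" where
  "info_set B \<longleftrightarrow> B \<subseteq> E \<and> (\<forall>c\<in>C. c \<inter> B = {} \<longrightarrow> c = {})"

text \<open>Spanning sets of least cardinality are exactly the bases of that matroid.\<close>

definition bases :: "'a set set" where
  "bases = {B. info_set B \<and> (\<forall>B'. info_set B' \<longrightarrow> card B \<le> card B')}"

lemma finite_code: "finite C"
  by (rule finite_subset[of _ "Pow E"]) (auto simp: finite_E dest: code_subset)

lemma info_set_E: "info_set E"
  unfolding info_set_def using code_subset by blast

lemma bases_nonempty: "bases \<noteq> {}"
proof -
  obtain B where "info_set B" "\<forall>B'. info_set B' \<longrightarrow> card B \<le> card B'"
    using ex_has_least_nat[of info_set E card] info_set_E by blast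
  then show ?thesis unfolding bases_def by blast
qed

lemma base_info_set: "B \<in> bases \<Longrightarrow> info_set B"
  unfolding bases_def by simp

lemma base_subset: "B \<in> bases \<Longrightarrow> B \<subseteq> E"
  using base_info_set unfolding info_set_def by blast

lemma finite_base: "B \<in> bases \<Longrightarrow> finite B"
  using base_subset finite_E finite_subset by blast

lemma finite_bases: "finite bases"
  by (rule finite_subset[of _ "Pow E"]) (auto simp: finite_E dest: base_subset)

lemma info_set_not_smaller:
  assumes "B \<in> bases" "info_set B'" shows "card B \<le> card B'"
  using assms unfolding bases_def by simp

lemma base_restrict_inject:
  assumes "B \<in> bases" "c \<in> C" "c \<inter> B = {}" shows "c = {}"
  using base_info_set[OF assms(1)] assms(2,3) unfolding info_set_def by blast

text \<open>By minimality \<open>B - {g}\<close> is no information set, which yields a codeword with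
  trace \<open>{g}\<close> on \<open>B\<close>. Adding these dual codewords produces every
  trace.\<close>

lemma base_codeword_prefix:
  assumes B: "B \<in> bases" and X: "X \<subseteq> B"
  shows "\<exists>c\<in>C. c \<inter> B = X"
proof -
  have dual: "\<exists>d\<in>C. d \<inter> B = {g}" if "g \<in> B" for g
  proof -
    have "card (B - {g}) < card B"
      using finite_base[OF B] that by (rule card_Diff1_less)
    then have "\<not> info_set (B - {g})"
      using info_set_not_smaller[OF B, of "B - {g}"] by linarith
    then obtain d where d: "d \<in> C" "d \<inter> (B - {g}) = {}" "d \<noteq> {}"
      using base_subset[OF B] unfolding info_set_def by blast
    then have "d \<inter> B \<noteq> {}" using base_restrict_inject[OF B] by blast
    with d show ?thesis by blast
  qed
  have "finite X" using finite_base[OF B] X finite_subset by blast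
  then show ?thesis using X
  proof (induction X)
    case empty
    then show ?case using empty_code by blast
  next
    case (insert g X)
    then obtain c d where c: "c \<in> C" "c \<inter> B = X" and d: "d \<in> C" "d \<inter> B = {g}"
      using dual[of g] by auto
    have "sym_diff c d \<inter> B = sym_diff (c \<inter> B) (d \<inter> B)" by blast
    also have "\<dots> = insert g X" using c(2) d(2) insert.hyps by auto
    finally have "sym_diff c d \<inter> B = insert g X" .
    then show ?case
      using sym_diff_code[OF c(1) d(1)] by (intro bexI[of _ "sym_diff c d"]) simp_all
  qed
qed

lemma two_power_card_base_le:
  assumes B: "B \<in> bases" shows "2 ^ card B \<le> card C"
proof -
  have "Pow B \<subseteq> (\<lambda>c. c \<inter> B) ` C"
    using base_codeword_prefix[OF B] by (metis (no_types, lifting) PowD image_eqI subsetI)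
  then have "card (Pow B) \<le> card C"
    using surj_card_le[OF finite_code] by blast
  then show ?thesis using card_Pow[OF finite_base[OF B]] by simp
qed

text \<open>If no exchange worked, each \<open>g\<close> in \<open>c \<inter> B\<close> would have a
  codeword with trace \<open>{g}\<close> on \<open>B\<close> that avoids \<open>f\<close>. Adding
  all of them to \<open>c\<close> clears \<open>B\<close> but keeps \<open>f\<close>, a nonzero
  codeword vanishing on a base.\<close>

lemma base_exchange:
  assumes B: "B \<in> bases" and c: "c \<in> C" and f: "f \<in> c"
  shows "\<exists>g\<in>c \<inter> B. insert f (B - {g}) \<in> bases"
proof (rule ccontr)
  assume contra: "\<not> ?thesis"
  have dual: "\<exists>d\<in>C. d \<inter> B = {g} \<and> f \<notin> d" if g: "g \<in> c \<inter> B" for g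
  proof -
    let ?B = "insert f (B - {g})"
    have "card ?B \<le> Suc (card (B - {g}))" by (rule card_insert_le_m1) auto
    also have "\<dots> = card B"
      using finite_base[OF B] g by (metis IntD2 card.remove)
    finally have card: "card ?B \<le> card B" .
    have "\<not> info_set ?B"
    proof
      assume "info_set ?B"
      then have "?B \<in> bases"
        using card info_set_not_smaller[OF B] unfolding bases_def by force
      then show False using contra g by blast
    qed
    then obtain d where d: "d \<in> C" "d \<inter> ?B = {}" "d \<noteq> {}"
      using base_subset[OF B] code_subset[OF c] f unfolding info_set_def by blast
    then have "d \<inter> B \<noteq> {}" using base_restrict_inject[OF B] by blast
    with d show ?thesis by blast
  qed
  have clear: "\<exists>d\<in>C. f \<in> d \<and> d \<inter> B = (c \<inter> B) - X" if "finite X" "X \<subseteq> c \<inter> B" for X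
    using that
  proof (induction X)
    case empty
    then show ?case using c f by blast
  next
    case (insert g X)
    then obtain d where d: "d \<in> C" "f \<in> d" "d \<inter> B = (c \<inter> B) - X" by auto
    obtain d' where d': "d' \<in> C" "d' \<inter> B = {g}" "f \<notin> d'"
      using dual[of g] insert.prems by auto
    have "sym_diff d d' \<inter> B = sym_diff (d \<inter> B) (d' \<inter> B)" by blast
    also have "\<dots> = (c \<inter> B) - insert g X"
      using d(3) d'(2) insert.hyps insert.prems by auto
    finally have "sym_diff d d' \<inter> B = (c \<inter> B) - insert g X" .
    then show ?case
      using sym_diff_code[OF d(1) d'(1)] d(2) d'(3)
      by (intro bexI[of _ "sym_diff d d'"] conjI) simp_all
  qed
  obtain d where "d \<in> C" "f \<in> d" "d \<inter> B = {}"
    using clear[of "c \<inter> B"] finite_base[OF B] by auto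
  then show False using base_restrict_inject[OF B] by blast
qed

end

section \<open>Optimal convex combinations of bases\<close>

text \<open>Weights are total functions, so coordinates outside \<open>S\<close> are confined to the
  unit interval as well; Tychonoff's theorem then gives compactness in the product topology.\<close>

lemma compact_weights:
  fixes S :: "'b set"
  shows "compact {l :: 'b \<Rightarrow> real. (\<forall>i. 0 \<le> l i \<and> l i \<le> 1) \<and> sum l S = 1}"
proof -
  have "compactin (product_topology (\<lambda>i::'b. euclidean :: real topology) UNIV) (PiE UNIV (\<lambda>i. {0..1}))"
    by (simp add: compactin_PiE)
  then have "compact (PiE UNIV (\<lambda>i::'b. {0..1::real}))"
    by (simp add: euclidean_product_topology)
  moreover have "closed {l :: 'b \<Rightarrow> real. sum l S = 1}"
    by (intro closed_Collect_eq continuous_on_sum continuous_on_product_coordinates continuous_on_const)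
  ultimately have "compact (PiE UNIV (\<lambda>i::'b. {0..1::real}) \<inter> {l. sum l S = 1})"
    by (rule compact_Int_closed)
  also have "PiE UNIV (\<lambda>i::'b. {0..1::real}) \<inter> {l. sum l S = 1} =
      {l. (\<forall>i. 0 \<le> l i \<and> l i \<le> 1) \<and> sum l S = 1}"
    by auto
  finally show ?thesis .
qed

context binary_code
begin

text \<open>For a probability distribution \<open>l\<close> on bases, this is the probability that a
  random base contains \<open>e\<close>.\<close>

definition coverage :: "('a set \<Rightarrow> real) \<Rightarrow> 'a \<Rightarrow> real" where
  "coverage l e = (\<Sum>B\<in>bases. l B * of_bool (e \<in> B))"

text \<open>Linearity of expectation. It is used with \<open>h = 1\<close> for sizes of traces and
  with \<open>h = \<kappa>\<close> in the optimality conditions.\<close>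

lemma sum_coverage:
  assumes "S \<subseteq> E"
  shows "(\<Sum>e\<in>S. h e * coverage l e) = (\<Sum>B\<in>bases. l B * (\<Sum>e\<in>S \<inter> B. h e))"
proof -
  have "(\<Sum>e\<in>S. h e * coverage l e) = (\<Sum>B\<in>bases. \<Sum>e\<in>S. h e * (l B * of_bool (e \<in> B)))"
    unfolding coverage_def sum_distrib_left by (rule sum.swap)
  also have "\<dots> = (\<Sum>B\<in>bases. l B * (\<Sum>e\<in>S \<inter> B. h e))"
  proof (rule sum.cong[OF refl])
    fix B
    have "(\<Sum>e\<in>S. h e * (l B * of_bool (e \<in> B))) = (\<Sum>e\<in>S. if e \<in> B then l B * h e else 0)"
      by (rule sum.cong) auto
    also have "\<dots> = l B * (\<Sum>e\<in>S \<inter> B. h e)"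
      using finite_subset[OF assms finite_E] by (simp add: sum.inter_restrict[symmetric] sum_distrib_left)
    finally show "(\<Sum>e\<in>S. h e * (l B * of_bool (e \<in> B))) = l B * (\<Sum>e\<in>S \<inter> B. h e)" .
  qed
  finally show ?thesis .
qed

lemma coverage_nonneg: "(\<And>B. 0 \<le> l B) \<Longrightarrow> 0 \<le> coverage l e"
  unfolding coverage_def by (intro sum_nonneg) auto

lemma in_some_base:
  assumes "f \<in> \<Union>C" shows "\<exists>B\<in>bases. f \<in> B"
proof -
  obtain c B where "f \<in> c" "c \<in> C" "B \<in> bases" using assms bases_nonempty by blast
  then show ?thesis using base_exchange[of B c f] by blast
qed

text \<open>A continuous function attains its maximum on the compact set of weights. The uniform
  weights give it a positive value, so no coverage on \<open>E\<close> vanishes at the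
  maximiser.\<close>

lemma maximal_coverage:
  fixes w :: "'a \<Rightarrow> real"
  assumes w: "\<And>e. e \<in> E \<Longrightarrow> 0 < w e" and cover: "E \<subseteq> \<Union>C"
  obtains l where "\<And>B. 0 \<le> l B" "sum l bases = 1" "\<And>e. e \<in> E \<Longrightarrow> 0 < coverage l e"
    "\<And>l'. (\<And>B. 0 \<le> l' B) \<Longrightarrow> (\<And>B. l' B \<le> 1) \<Longrightarrow> sum l' bases = 1 \<Longrightarrow>
       (\<Prod>e\<in>E. coverage l' e powr w e) \<le> (\<Prod>e\<in>E. coverage l e powr w e)"
proof -
  define K where "K = {l :: 'a set \<Rightarrow> real. (\<forall>B. 0 \<le> l B \<and> l B \<le> 1) \<and> sum l bases = 1}"
  \<comment> \<open>The exponential of \<open>\<Sum>e. w e * ln (coverage l e)\<close>; unlike that sum it is continuous where a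
    coverage vanishes.\<close>
  define \<phi> where "\<phi> l = (\<Prod>e\<in>E. coverage l e powr w e)" for l
  define l0 where "l0 B = 1 / real (card bases)" for B :: "'a set"
  have cb: "card bases > 0" using bases_nonempty finite_bases by (simp add: card_gt_0_iff)
  have l0: "l0 \<in> K" using cb unfolding K_def l0_def by (auto simp: field_simps)
  have l0_pos: "0 < coverage l0 e" if "e \<in> E" for e
  proof -
    obtain B where B: "B \<in> bases" "e \<in> B" using in_some_base[of e] cover \<open>e \<in> E\<close> by blast
    have "0 < (\<Sum>B\<in>bases. l0 B * of_bool (e \<in> B))"
      using finite_bases B cb by (intro sum_pos2[of _ B]) (auto simp: l0_def)
    then show ?thesis unfolding coverage_def .
  qed
  have "compact K" unfolding K_def by (rule compact_weights)
  moreover have "continuous_on K \<phi>"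
    unfolding \<phi>_def
  proof (intro continuous_on_prod continuous_on_powr' continuous_on_const ballI conjI impI)
    fix e show "continuous_on K (\<lambda>l. coverage l e)"
      unfolding coverage_def
      by (intro continuous_on_sum continuous_on_mult continuous_on_const)
        (rule continuous_on_subset[OF continuous_on_product_coordinates], simp)
  qed (use w coverage_nonneg in \<open>auto simp: K_def\<close>)
  ultimately obtain l where l: "l \<in> K" "\<And>l'. l' \<in> K \<Longrightarrow> \<phi> l' \<le> \<phi> l"
    using continuous_attains_sup[of K \<phi>] l0 by blast
  have "0 < \<phi> l0" unfolding \<phi>_def using l0_pos by (intro prod_pos) (metis less_irrefl powr_gt_zero)
  then have "\<phi> l \<noteq> 0" using l(2)[OF l0] by simp
  then have "coverage l e \<noteq> 0" if "e \<in> E" for e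
    using that finite_E unfolding \<phi>_def by auto
  moreover have "0 \<le> coverage l e" for e using l(1) coverage_nonneg[of l e] unfolding K_def by auto
  ultimately have "0 < coverage l e" if "e \<in> E" for e using that by (simp add: order_less_le)
  then show ?thesis using l that[of l] unfolding K_def \<phi>_def by auto
qed

text \<open>Moving \<open>l\<close> towards a single base \<open>B\<close> changes the logarithmic
  objective at rate \<open>sum \<kappa> B - sum w E\<close>, which optimality makes nonpositive. The
  \<open>l\<close>-average of these rates is 0, so bases in the support attain the maximal
  \<open>\<kappa>\<close>-weight, and exchanging some \<open>g\<close> in
  \<open>c \<inter> B\<close> for \<open>f\<close> cannot increase it.\<close>

theorem balanced_base_weights:
  fixes w :: "'a \<Rightarrow> real"
  assumes w: "\<And>e. e \<in> E \<Longrightarrow> 0 < w e" and cover: "E \<subseteq> \<Union>C"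
  obtains l where "\<And>B. 0 \<le> l B" "sum l bases = 1" "\<And>e. e \<in> E \<Longrightarrow> 0 < coverage l e"
    "\<And>B c f. B \<in> bases \<Longrightarrow> 0 < l B \<Longrightarrow> c \<in> C \<Longrightarrow> f \<in> c \<Longrightarrow>
       \<exists>e\<in>c \<inter> B. w f / coverage l f \<le> w e / coverage l e"
proof -
  obtain l where l0: "\<And>B. 0 \<le> l B" and l1: "sum l bases = 1"
    and pos: "\<And>e. e \<in> E \<Longrightarrow> 0 < coverage l e"
    and max: "\<And>l'. (\<And>B. 0 \<le> l' B) \<Longrightarrow> (\<And>B. l' B \<le> 1) \<Longrightarrow> sum l' bases = 1 \<Longrightarrow>
       (\<Prod>e\<in>E. coverage l' e powr w e) \<le> (\<Prod>e\<in>E. coverage l e powr w e)"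
    by (rule maximal_coverage[of w, OF w cover]) blast+
  define u where "u = coverage l"
  define \<kappa> where "\<kappa> e = w e / u e" for e
  have kw: "\<kappa> e * u e = w e" if "e \<in> E" for e
    using pos[OF that] by (simp add: \<kappa>_def u_def)
  have base_le: "sum \<kappa> B \<le> sum w E" if B: "B \<in> bases" for B
  proof -
    define b where "b e = (of_bool (e \<in> B) :: real)" for e
    define G where "G t = (\<Sum>e\<in>E. w e * ln ((1 - t) * u e + t * b e))" for t
    define D where "D = (\<Sum>e\<in>E. w e * ((b e - u e) / u e))"
    have "(G has_real_derivative D) (at 0)"
      unfolding G_def D_def
    proof (intro DERIV_sum DERIV_cmult)
      fix e assume "e \<in> E"
      then have "0 < u e" using pos by (simp add: u_def)
      then show "((\<lambda>t. ln ((1 - t) * u e + t * b e)) has_real_derivative (b e - u e) / u e) (at 0)"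
        by (auto intro!: derivative_eq_intros)
    qed
    moreover have "G t \<le> G 0" if t: "0 < t" "t < 1" for t
    proof -
      \<comment> \<open>Cut to zero outside \<open>bases\<close>: maximality compares only weights
        bounded by 1 everywhere, and \<open>l\<close> is known to be so only on
        \<open>bases\<close>.\<close>
      define l' where "l' B' = (1 - t) * (if B' \<in> bases then l B' else 0) + t * of_bool (B' = B)" for B'
      have lle: "l B' \<le> 1" if "B' \<in> bases" for B'
        using member_le_sum[of B' bases l] that l0 finite_bases l1 by simp
      have cov: "coverage l' e = (1 - t) * u e + t * b e" for e
      proof -
        have "coverage l' e = (\<Sum>B'\<in>bases. (1 - t) * (l B' * of_bool (e \<in> B')) +
            (if B' = B then t * b e else 0))"
          unfolding coverage_def l'_def by (intro sum.cong) (auto simp: algebra_simps b_def)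
        also have "\<dots> = (1 - t) * u e + t * b e"
          using B finite_bases
          by (simp add: sum.distrib sum_distrib_left[symmetric] u_def coverage_def)
        finally show ?thesis .
      qed
      have "sum l' bases = (1 - t) * sum l bases + t"
        unfolding l'_def using B finite_bases
        by (simp add: sum.distrib sum_distrib_left[symmetric] of_bool_def)
      then have "sum l' bases = 1" using l1 by simp
      moreover have "0 \<le> l' B'" for B' unfolding l'_def using t l0 by simp
      moreover have "l' B' \<le> 1" for B'
      proof -
        have "l' B' \<le> (1 - t) * 1 + t * 1"
          unfolding l'_def using t lle by (intro add_mono mult_left_mono) auto
        then show ?thesis by simp
      qed
      ultimately have le: "(\<Prod>e\<in>E. coverage l' e powr w e) \<le> (\<Prod>e\<in>E. u e powr w e)"
        using max[of l'] by (simp add: u_def)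
      have upos: "0 < u e" if "e \<in> E" for e using pos that by (simp add: u_def)
      have cpos: "0 < coverage l' e" if "e \<in> E" for e
        using upos[OF that] t unfolding cov by (simp add: b_def add_pos_nonneg)
      then have "ln (\<Prod>e\<in>E. coverage l' e powr w e) = G t"
        unfolding G_def cov[symmetric] using finite_E
        by (subst ln_prod) (simp_all add: cpos[THEN order_less_imp_not_eq2])
      moreover have "ln (\<Prod>e\<in>E. u e powr w e) = G 0"
        unfolding G_def using finite_E
        by (subst ln_prod) (simp_all add: upos[THEN order_less_imp_not_eq2])
      moreover have "0 < (\<Prod>e\<in>E. coverage l' e powr w e)"
        by (intro prod_pos) (simp add: cpos[THEN order_less_imp_not_eq2])
      ultimately show ?thesis using le by (metis ln_mono)
    qed
    \<comment> \<open>A positive derivative would lift \<open>G\<close> above \<open>G 0\<close>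
      immediately to the right of 0.\<close>
    ultimately have "\<not> 0 < D"
      using DERIV_pos_inc_right[of G D 0]
      by (metis add_0 dense_order_class.dense linorder_not_less min_less_iff_conj zero_less_one)
    then have "D \<le> 0" by simp
    have "D = (\<Sum>e\<in>E. \<kappa> e * b e - w e)"
      unfolding D_def u_def \<kappa>_def using pos[THEN order_less_imp_not_eq2]
      by (intro sum.cong) (simp_all add: diff_divide_distrib right_diff_distrib)
    also have "\<dots> = sum \<kappa> B - sum w E"
    proof -
      have "(\<Sum>e\<in>E. \<kappa> e * b e) = (\<Sum>e\<in>E. if e \<in> B then \<kappa> e else 0)"
        by (rule sum.cong) (auto simp: b_def)
      also have "\<dots> = sum \<kappa> (E \<inter> B)" using finite_E by (simp add: sum.inter_restrict)
      also have "E \<inter> B = B" using base_subset[OF B] by blast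
      finally show ?thesis by (simp add: sum_subtractf)
    qed
    finally show ?thesis using \<open>D \<le> 0\<close> by simp
  qed
  have base_eq: "sum \<kappa> B = sum w E" if B: "B \<in> bases" "0 < l B" for B
  proof -
    \<comment> \<open>The average of \<open>sum \<kappa> B\<close> equals its upper bound
      \<open>sum w E\<close>, so no base of positive weight can fall short of it.\<close>
    have "(\<Sum>B\<in>bases. l B * sum \<kappa> (E \<inter> B)) = (\<Sum>e\<in>E. \<kappa> e * u e)"
      unfolding u_def by (rule sum_coverage[symmetric]) simp
    also have "\<dots> = sum w E" using kw by simp
    also have "(\<Sum>B\<in>bases. l B * sum \<kappa> (E \<inter> B)) = (\<Sum>B\<in>bases. l B * sum \<kappa> B)"
      using base_subset by (intro sum.cong refl) (simp add: Int_absorb1)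
    finally have "(\<Sum>B\<in>bases. l B * (sum w E - sum \<kappa> B)) = 0"
      using l1 by (simp add: right_diff_distrib sum_subtractf sum_distrib_right[symmetric])
    then have "l B * (sum w E - sum \<kappa> B) = 0"
      using B(1) finite_bases l0 base_le by (subst (asm) sum_nonneg_eq_0_iff) auto
    then show ?thesis using B(2) by simp
  qed
  have "\<exists>e\<in>c \<inter> B. \<kappa> f \<le> \<kappa> e" if B: "B \<in> bases" "0 < l B" and c: "c \<in> C" "f \<in> c" for B c f
  proof (cases "f \<in> B")
    case False
    obtain g where g: "g \<in> c \<inter> B" "insert f (B - {g}) \<in> bases"
      using base_exchange[OF B(1) c] by blast
    have "sum \<kappa> (insert f (B - {g})) = sum \<kappa> B - \<kappa> g + \<kappa> f"
      using False g(1) finite_base[OF B(1)] by (simp add: sum_diff1)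
    then show ?thesis using base_le[OF g(2)] base_eq[OF B] g(1) by force
  qed (use c in auto)
  then show ?thesis using that[of l] l0 l1 pos unfolding \<kappa>_def u_def by blast
qed

end

section \<open>Sparsification of codes\<close>

lemma sum_power_card_Pow:
  fixes q :: real
  assumes "finite B" shows "(\<Sum>X\<in>Pow B. q ^ card X) = (1 + q) ^ card B"
  using prod_add[OF assms, of "\<lambda>_. q" "\<lambda>_. 1"] by (simp add: add.commute)

context binary_code
begin

text \<open>Codewords that agree on \<open>T\<close> count once. The empty trace is removed because
  it would contribute \<open>exp 0 = 1\<close> to the union bound.\<close>

definition restrictions :: "'a set \<Rightarrow> 'a set set" where
  "restrictions T = (\<lambda>c. c \<inter> T) ` C - {{}}"

lemma finite_restrictions: "finite (restrictions T)"
  unfolding restrictions_def using finite_code by simp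

lemma restrictions_subset: "S \<in> restrictions T \<Longrightarrow> S \<subseteq> E"
  unfolding restrictions_def using code_subset by blast

text \<open>By linearity \<open>sep\<close> says that a restricted codeword is determined by its
  trace on \<open>B\<close>. So traces inject into the nonempty subsets of \<open>B\<close>, and the
  binomial theorem finishes.\<close>

lemma sum_power_restrictions_le:
  fixes q :: real
  assumes q: "0 \<le> q" and B: "B \<in> bases"
    and sep: "\<And>c. c \<in> C \<Longrightarrow> c \<inter> T \<noteq> {} \<Longrightarrow> c \<inter> T \<inter> B \<noteq> {}"
  shows "(\<Sum>S\<in>restrictions T. q ^ card (S \<inter> B)) \<le> (1 + q) ^ card B - 1"
proof -
  let ?R = "restrictions T"
  have inj: "inj_on (\<lambda>S. S \<inter> B) ?R"
  proof (rule inj_onI)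
    fix S S' assume "S \<in> ?R" "S' \<in> ?R" and eq: "S \<inter> B = S' \<inter> B"
    then obtain c c' where c: "c \<in> C" "S = c \<inter> T" "c' \<in> C" "S' = c' \<inter> T"
      unfolding restrictions_def by blast
    have "sym_diff c c' \<inter> T \<inter> B = sym_diff (S \<inter> B) (S' \<inter> B)" unfolding c by blast
    then have "sym_diff c c' \<inter> T \<inter> B = {}" using eq by simp
    then have "sym_diff c c' \<inter> T = {}" using sep[OF sym_diff_code[OF c(1,3)]] by (rule contrapos_pp)
    then show "S = S'" unfolding c by blast
  qed
  have "(\<Sum>S\<in>?R. q ^ card (S \<inter> B)) = (\<Sum>X\<in>(\<lambda>S. S \<inter> B) ` ?R. q ^ card X)"
    using inj by (simp add: sum.reindex)
  also have "\<dots> \<le> (\<Sum>X\<in>Pow B - {{}}. q ^ card X)"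
  proof (rule sum_mono2)
    show "(\<lambda>S. S \<inter> B) ` ?R \<subseteq> Pow B - {{}}"
      using sep unfolding restrictions_def by blast
  qed (use finite_base[OF B] q in auto)
  also have "\<dots> = (1 + q) ^ card B - 1"
    using finite_base[OF B] by (simp add: sum_diff1 sum_power_card_Pow)
  finally show ?thesis .
qed

text \<open>\<open>sum (coverage l) S\<close> is the mean of \<open>card (S \<inter> B)\<close>, so
  Jensen's inequality for \<open>exp\<close> reduces the sum to one base in the support of
  \<open>l\<close> at a time.\<close>

lemma sum_exp_restrictions_le:
  fixes l :: "'a set \<Rightarrow> real"
  assumes l: "\<And>B. 0 \<le> l B" "sum l bases = 1"
    and k: "\<And>B. B \<in> bases \<Longrightarrow> card B \<le> k"
    and sep: "\<And>B c. B \<in> bases \<Longrightarrow> 0 < l B \<Longrightarrow> c \<in> C \<Longrightarrow> c \<inter> T \<noteq> {} \<Longrightarrow> c \<inter> T \<inter> B \<noteq> {}"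
  shows "(\<Sum>S\<in>restrictions T. exp (- \<tau> * sum (coverage l) S)) \<le> (1 + exp (- \<tau>)) ^ k - 1"
proof -
  let ?q = "exp (- \<tau>)"
  have jensen: "exp (- \<tau> * sum (coverage l) S) \<le> (\<Sum>B\<in>bases. l B * ?q ^ card (S \<inter> B))"
    if S: "S \<in> restrictions T" for S
  proof -
    have "sum (coverage l) S = (\<Sum>B\<in>bases. l B * real (card (S \<inter> B)))"
      using sum_coverage[OF restrictions_subset[OF S], of "\<lambda>_. 1" l] by simp
    then have "exp (- \<tau> * sum (coverage l) S) =
        exp (\<Sum>B\<in>bases. l B *\<^sub>R (real (card (S \<inter> B)) * - \<tau>))"
      by (simp add: sum_distrib_left sum_negf mult_ac)
    also have "\<dots> \<le> (\<Sum>B\<in>bases. l B * exp (real (card (S \<inter> B)) * - \<tau>))"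
      by (rule convex_on_sum[OF finite_bases bases_nonempty exp_convex l(2)]) (use l(1) in auto)
    finally show ?thesis by (simp only: exp_of_nat_mult)
  qed
  have "(\<Sum>S\<in>restrictions T. exp (- \<tau> * sum (coverage l) S)) \<le>
      (\<Sum>S\<in>restrictions T. \<Sum>B\<in>bases. l B * ?q ^ card (S \<inter> B))"
    by (intro sum_mono jensen)
  also have "\<dots> = (\<Sum>B\<in>bases. l B * (\<Sum>S\<in>restrictions T. ?q ^ card (S \<inter> B)))"
    unfolding sum_distrib_left by (rule sum.swap)
  also have "\<dots> \<le> (\<Sum>B\<in>bases. l B * ((1 + ?q) ^ k - 1))"
  proof (rule sum_mono)
    fix B assume B: "B \<in> bases"
    show "l B * (\<Sum>S\<in>restrictions T. ?q ^ card (S \<inter> B)) \<le> l B * ((1 + ?q) ^ k - 1)"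
    proof (cases "l B = 0")
      case False
      then have "0 < l B" using l(1)[of B] by simp
      then have "(\<Sum>S\<in>restrictions T. ?q ^ card (S \<inter> B)) \<le> (1 + ?q) ^ card B - 1"
        using sum_power_restrictions_le[OF _ B, of ?q T] sep[OF B] by simp
      also have "\<dots> \<le> (1 + ?q) ^ k - 1"
        using power_increasing[OF k[OF B], of "1 + ?q"] by simp
      finally show ?thesis using l(1) by (rule mult_left_mono)
    qed simp
  qed
  also have "\<dots> = (1 + ?q) ^ k - 1" using l(2) by (simp add: sum_distrib_right[symmetric])
  finally show ?thesis .
qed

end

text \<open>There are at most \<open>k\<close> levels, each contributing the bracket with
  \<open>exp (- \<tau>) = 1 / (16 * k^2)\<close>. The power is at most
  \<open>exp (1 / (16 * k))\<close>, hence at most \<open>1 + 1 / (8 * k)\<close>, for a total of at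
  most 1/8.\<close>

lemma union_bound_estimate:
  assumes "1 \<le> k"
  shows "real k * ((1 + 1 / (16 * (real k)\<^sup>2)) ^ k - 1) < 1 / 4"
proof -
  define y where "y = 1 / (16 * real k)"
  have k: "1 \<le> real k" using assms by simp
  then have y: "0 < y" "y \<le> 1" "real k * y = 1 / 16" by (auto simp: y_def field_simps)
  have "(1 + 1 / (16 * (real k)\<^sup>2)) ^ k \<le> exp (1 / (16 * (real k)\<^sup>2)) ^ k"
    by (intro power_mono exp_ge_add_one_self) simp
  also have "\<dots> = exp y"
    using k by (simp add: exp_of_nat_mult[symmetric] y_def power2_eq_square)
  also have "\<dots> \<le> 1 + y + y\<^sup>2" using y by (intro exp_le_quadratic) auto
  also have "\<dots> \<le> 1 + 2 * y"
    using y mult_left_mono[of y 1 y] by (simp add: power2_eq_square)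
  finally have "real k * ((1 + 1 / (16 * (real k)\<^sup>2)) ^ k - 1) \<le> real k * (2 * y)"
    using k by (intro mult_left_mono) auto
  also have "\<dots> = 1 / 8" using y(3) by simp
  finally show ?thesis by simp
qed

context binary_code
begin

text \<open>The sample is drawn according to \<open>u\<close>, simultaneously for the traces on all
  levels of \<open>\<kappa>\<close>, but its multipliers are applied to \<open>w\<close>. Its size
  is governed by \<open>sum u E\<close>, the mean cardinality of a base, which is at most
  \<open>k\<close>.\<close>

theorem code_sparsification:
  fixes w :: "'a \<Rightarrow> real"
  assumes w: "\<And>e. e \<in> E \<Longrightarrow> 0 < w e" and cover: "E \<subseteq> \<Union>C"
    and card_C: "card C \<le> 2 ^ k" and k: "1 \<le> k" and eps: "0 < \<epsilon>" "\<epsilon> \<le> 1"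
  obtains X w' where "X \<subseteq> E" "\<And>e. e \<in> X \<Longrightarrow> 0 < w' e"
    "real (card X) \<le> 16 * real k * ln (4 * real k) / \<epsilon>\<^sup>2 + 1"
    "\<And>c. c \<in> C \<Longrightarrow> \<bar>sum w' (c \<inter> X) - sum w c\<bar> \<le> \<epsilon> * sum w c"
proof -
  obtain l where l: "\<And>B. 0 \<le> l B" "sum l bases = 1" and cov_pos: "\<And>e. e \<in> E \<Longrightarrow> 0 < coverage l e"
    and balanced: "\<And>B c f. B \<in> bases \<Longrightarrow> 0 < l B \<Longrightarrow> c \<in> C \<Longrightarrow> f \<in> c \<Longrightarrow>
       \<exists>e\<in>c \<inter> B. w f / coverage l f \<le> w e / coverage l e"
    by (rule balanced_base_weights[of w, OF w cover]) blast+
  define u where "u = coverage l"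
  define \<kappa> where "\<kappa> e = w e / u e" for e
  define T where "T t = {e. t \<le> \<kappa> e}" for t
  \<comment> \<open>This makes \<open>exp (- \<tau>)\<close> equal to \<open>1 / (16 * k^2)\<close>,
    small enough for a union bound over \<open>k\<close> levels.\<close>
  define \<tau> where "\<tau> = 2 * ln (4 * real k)"
  define F where "F = (\<Union>t\<in>\<kappa> ` E. restrictions (T t))"
  have u: "0 < u e" if "e \<in> E" for e using cov_pos that by (simp add: u_def)
  have bal: "\<exists>e\<in>c \<inter> B. \<kappa> f \<le> \<kappa> e" if "B \<in> bases" "0 < l B" "c \<in> C" "f \<in> c" for B c f
    using balanced[OF that] by (simp add: \<kappa>_def u_def)
  have kr: "1 \<le> real k" using k by simp
  have tau: "0 < \<tau>" using kr by (simp add: \<tau>_def)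
  have card_base: "card B \<le> k" if "B \<in> bases" for B
  proof -
    have "(2::nat) ^ card B \<le> 2 ^ k" using two_power_card_base_le[OF that] card_C by linarith
    then show ?thesis by simp
  qed
  have "card (\<kappa> ` E) \<le> k"
  proof -
    obtain B where B: "B \<in> bases" "0 < l B"
    proof (rule ccontr)
      assume "\<not> thesis"
      then have "\<forall>B\<in>bases. l B = 0" using that l(1) less_eq_real_def by metis
      then show False using l(2) by simp
    qed
    \<comment> \<open>Every level meets the fixed base \<open>B\<close>: take a base \<open>B'\<close> of the support through \<open>f\<close> and a codeword
      meeting \<open>B'\<close> only in \<open>f\<close>, and compare \<open>f\<close> with \<open>B\<close> and back.\<close>
    have "\<kappa> ` E \<subseteq> \<kappa> ` B"
    proof (rule image_subsetI)
      fix f assume f: "f \<in> E"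
      have "\<exists>B'\<in>bases. 0 < l B' \<and> f \<in> B'"
      proof (rule ccontr)
        assume contra: "\<not> ?thesis"
        then have "l B' * of_bool (f \<in> B') = 0" if "B' \<in> bases" for B'
          using that contra l(1)[of B'] by (cases "l B' = 0") (auto simp: less_le)
        then have "u f = 0" unfolding u_def coverage_def by (intro sum.neutral ballI)
        then show False using u[OF f] by simp
      qed
      then obtain B' where B': "B' \<in> bases" "0 < l B'" "f \<in> B'" by blast
      obtain c where c: "c \<in> C" "c \<inter> B' = {f}"
        using base_codeword_prefix[OF B'(1), of "{f}"] B'(3) by blast
      obtain e where e: "e \<in> c \<inter> B" "\<kappa> f \<le> \<kappa> e" using bal[OF B c(1)] c(2) by blast
      have "e \<in> c" using e(1) by blast
      then have "\<kappa> e \<le> \<kappa> f" using bal[OF B'(1,2) c(1)] unfolding c(2) by blast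
      then have "\<kappa> f = \<kappa> e" using e(2) by simp
      then show "\<kappa> f \<in> \<kappa> ` B" using e(1) by blast
    qed
    then have "card (\<kappa> ` E) \<le> card B"
      using finite_base[OF B(1)] by (meson card_image_le card_mono finite_imageI le_trans)
    then show ?thesis using card_base[OF B(1)] by simp
  qed
  moreover have level: "(\<Sum>S\<in>restrictions (T t). exp (- \<tau> * sum u S)) \<le> (1 + 1 / (16 * (real k)\<^sup>2)) ^ k - 1" for t
  proof -
    have "exp (- \<tau>) = exp (- ln (4 * real k)) * exp (- ln (4 * real k))"
      by (simp add: \<tau>_def exp_add[symmetric])
    also have "\<dots> = 1 / (16 * (real k)\<^sup>2)"
      using kr by (simp add: exp_minus power2_eq_square inverse_eq_divide)
    finally have q: "exp (- \<tau>) = 1 / (16 * (real k)\<^sup>2)" .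
    \<comment> \<open>The balance condition finds in \<open>c \<inter> B\<close> an element at least
      as high as \<open>f\<close>, hence still in \<open>T t\<close>.\<close>
    have "c \<inter> T t \<inter> B \<noteq> {}" if B: "B \<in> bases" "0 < l B" and c: "c \<in> C" "c \<inter> T t \<noteq> {}" for B c
    proof -
      obtain f where f: "f \<in> c" "t \<le> \<kappa> f" using c(2) by (auto simp: T_def)
      obtain e where "e \<in> c \<inter> B" "\<kappa> f \<le> \<kappa> e" using bal[OF B c(1) f(1)] by blast
      then show ?thesis using f(2) by (auto simp: T_def)
    qed
    then show ?thesis
      using sum_exp_restrictions_le[OF l card_base, of "T t" \<tau>] unfolding q u_def by blast
  qed
  ultimately have "real (card (\<kappa> ` E)) * ((1 + 1 / (16 * (real k)\<^sup>2)) ^ k - 1) \<le>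
      real k * ((1 + 1 / (16 * (real k)\<^sup>2)) ^ k - 1)"
    by (intro mult_right_mono) auto
  also have "\<dots> < 1 / 4" by (rule union_bound_estimate[OF k])
  finally have small: "real (card (\<kappa> ` E)) * ((1 + 1 / (16 * (real k)\<^sup>2)) ^ k - 1) < 1 / 4" .
  have finF: "finite F" unfolding F_def using finite_E finite_restrictions by auto
  \<comment> \<open>The same trace may occur on several levels; summing over pairs can only
    overcount nonnegative terms.\<close>
  have "F = snd ` (SIGMA t:\<kappa> ` E. restrictions (T t))" unfolding F_def by force
  then have "(\<Sum>S\<in>F. exp (- \<tau> * sum u S)) \<le>
      sum ((\<lambda>S. exp (- \<tau> * sum u S)) \<circ> snd) (SIGMA t:\<kappa> ` E. restrictions (T t))"
    using finite_E finite_restrictions by (simp only:) (intro sum_image_le, auto)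
  also have "\<dots> = (\<Sum>t\<in>\<kappa> ` E. \<Sum>S\<in>restrictions (T t). exp (- \<tau> * sum u S))"
    using finite_E finite_restrictions by (simp add: sum.Sigma case_prod_beta comp_def)
  also have "\<dots> \<le> (\<Sum>t\<in>\<kappa> ` E. (1 + 1 / (16 * (real k)\<^sup>2)) ^ k - 1)"
    by (intro sum_mono level)
  also have "\<dots> < 1 / 4" using small by simp
  finally have union: "(\<Sum>S\<in>F. exp (- \<tau> * sum u S)) < 1 / 4" .
  have F_sub: "S \<subseteq> E" if "S \<in> F" for S using that restrictions_subset unfolding F_def by blast
  obtain X v where X: "X \<subseteq> E" and v: "\<And>e. e \<in> E \<Longrightarrow> 0 < (v e :: real)"
    and card_X: "real (card X) \<le> 8 * \<tau> / \<epsilon>\<^sup>2 * sum u E + 1"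
    and approx: "\<And>S. S \<in> F \<Longrightarrow> \<bar>(\<Sum>e\<in>S \<inter> X. v e * u e) - sum u S\<bar> \<le> \<epsilon> * sum u S"
    by (rule exists_sparse_sample[OF finite_E u finF F_sub eps tau union]) blast+
  define w' where "w' e = v e * w e" for e
  have "sum u E \<le> real k"
  proof -
    have "sum u E = (\<Sum>B\<in>bases. l B * real (card (E \<inter> B)))"
      using sum_coverage[of E "\<lambda>_. 1" l] by (simp add: u_def)
    also have "\<dots> \<le> (\<Sum>B\<in>bases. l B * real k)"
      using card_base base_subset l(1) by (intro sum_mono mult_left_mono) (simp_all add: Int_absorb1)
    also have "\<dots> = real k" using l(2) by (simp add: sum_distrib_right[symmetric])
    finally show ?thesis .
  qed
  then have "8 * \<tau> / \<epsilon>\<^sup>2 * sum u E \<le> 8 * \<tau> / \<epsilon>\<^sup>2 * real k"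
    using tau by (intro mult_left_mono) auto
  then have "real (card X) \<le> 16 * real k * ln (4 * real k) / \<epsilon>\<^sup>2 + 1"
    using card_X by (simp add: \<tau>_def mult_ac)
  moreover have "\<bar>sum w' (c \<inter> X) - sum w c\<bar> \<le> \<epsilon> * sum w c" if c: "c \<in> C" for c
  proof -
    \<comment> \<open>Extension by zero puts the sampled and the original mass on the same index set
      \<open>c\<close>, so that the layer-cake lemma applies to their difference.\<close>
    define z where "z e = (if e \<in> X then v e * u e else 0)" for e
    have finc: "finite c" using code_subset[OF c] finite_E finite_subset by blast
    have cE: "e \<in> E" if "e \<in> c" for e using code_subset[OF c] that by blast
    have ku: "\<kappa> e * u e = w e" if "e \<in> c" for e using u[OF cE[OF that]] by (simp add: \<kappa>_def)
    have kpos: "0 \<le> \<kappa> e" if "e \<in> c" for e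
      using u[OF cE[OF that]] w[OF cE[OF that]] by (simp add: \<kappa>_def)
    have lev: "\<bar>sum z S - sum u S\<bar> \<le> \<epsilon> * sum u S" if "t \<in> \<kappa> ` c" "S = {e \<in> c. t \<le> \<kappa> e}" for t S
    proof -
      have "S \<in> restrictions (T t)" using that c by (auto simp: restrictions_def T_def)
      then have "S \<in> F" using that(1) cE unfolding F_def by blast
      moreover have "sum z S = (\<Sum>e\<in>S \<inter> X. v e * u e)"
        using that(2) finc by (simp add: z_def sum.inter_restrict)
      ultimately show ?thesis using approx by simp
    qed
    have upper: "0 \<le> (\<Sum>e\<in>c. \<kappa> e * ((1 + \<epsilon>) * u e - z e))"
      using finc kpos
    proof (rule layer_cake_nonneg)
      fix t assume "t \<in> \<kappa> ` c"
      from lev[OF this refl] show "0 \<le> (\<Sum>e\<in>{e \<in> c. t \<le> \<kappa> e}. (1 + \<epsilon>) * u e - z e)"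
        by (simp only: sum_subtractf sum_distrib_left[symmetric] abs_le_iff) (simp add: algebra_simps)
    qed
    have lower: "0 \<le> (\<Sum>e\<in>c. \<kappa> e * (z e - (1 - \<epsilon>) * u e))"
      using finc kpos
    proof (rule layer_cake_nonneg)
      fix t assume "t \<in> \<kappa> ` c"
      from lev[OF this refl] show "0 \<le> (\<Sum>e\<in>{e \<in> c. t \<le> \<kappa> e}. z e - (1 - \<epsilon>) * u e)"
        by (simp only: sum_subtractf sum_distrib_left[symmetric] abs_le_iff) (simp add: algebra_simps)
    qed
    have kz: "(\<Sum>e\<in>c. \<kappa> e * z e) = sum w' (c \<inter> X)"
    proof -
      have "(\<Sum>e\<in>c. \<kappa> e * z e) = (\<Sum>e\<in>c. if e \<in> X then w' e else 0)"
        using ku by (intro sum.cong) (auto simp: z_def w'_def mult_ac)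
      then show ?thesis using finc by (simp add: sum.inter_restrict)
    qed
    have kuw: "(\<Sum>e\<in>c. \<kappa> e * (a * u e)) = a * sum w c" for a
    proof -
      have "(\<Sum>e\<in>c. \<kappa> e * (a * u e)) = (\<Sum>e\<in>c. a * w e)"
        using ku by (intro sum.cong) (auto simp: mult_ac)
      then show ?thesis by (simp add: sum_distrib_left)
    qed
    have "sum w' (c \<inter> X) \<le> (1 + \<epsilon>) * sum w c"
      using upper unfolding right_diff_distrib sum_subtractf kz kuw by simp
    moreover have "(1 - \<epsilon>) * sum w c \<le> sum w' (c \<inter> X)"
      using lower unfolding right_diff_distrib sum_subtractf kz kuw by simp
    ultimately show ?thesis by (simp add: abs_le_iff algebra_simps)
  qed
  moreover have "0 < w' e" if "e \<in> X" for e
    using v[of e] w[of e] X that by (auto simp: w'_def)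
  ultimately show ?thesis using that[of X w'] X by blast
qed

end

section \<open>Fourier analysis of Cayley graphs\<close>

lemma vecs_Suc: "vecs (Suc k) = Cons True ` vecs k \<union> Cons False ` vecs k"
  by (auto simp: vecs_def length_Suc_conv image_iff)

lemma finite_vecs: "finite (vecs k)"
  by (induction k) (simp_all add: vecs_Suc, simp add: vecs_def)

lemma sum_vecs_Suc:
  fixes h :: "bool list \<Rightarrow> 'b::comm_monoid_add"
  shows "(\<Sum>x\<in>vecs (Suc k). h x) = (\<Sum>x\<in>vecs k. h (True # x)) + (\<Sum>x\<in>vecs k. h (False # x))"
  unfolding vecs_Suc using finite_vecs
  by (subst sum.union_disjoint) (auto simp: sum.reindex)

lemma card_vecs: "card (vecs k) = 2 ^ k"
proof -
  have "(\<Sum>x\<in>vecs k. 1) = (2 ^ k :: nat)"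
    by (induction k) (simp_all only: sum_vecs_Suc power_Suc, simp_all add: vecs_def)
  then show ?thesis by simp
qed

lemma vadd_closed: "x \<in> vecs k \<Longrightarrow> y \<in> vecs k \<Longrightarrow> vadd x y \<in> vecs k"
  by (simp add: vecs_def vadd_def)

lemma vadd_Cons [simp]: "vadd (p # x) (q # y) = (p \<noteq> q) # vadd x y"
  by (simp add: vadd_def)

lemma vadd_Nil [simp]: "vadd [] [] = []"
  by (simp add: vadd_def)

lemma vadd_eq_iff:
  assumes "x \<in> vecs k" "y \<in> vecs k" "z \<in> vecs k"
  shows "vadd x y = z \<longleftrightarrow> vadd z y = x"
proof -
  have "length x = length y" "length y = length z" using assms by (auto simp: vecs_def)
  then show ?thesis by (induction x y z rule: list_induct3) auto
qed

lemma vadd_eq_vzero_iff: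
  assumes "x \<in> vecs k" "y \<in> vecs k"
  shows "vadd x y = vzero k \<longleftrightarrow> x = y"
proof -
  have "length x = length y" "length x = k" using assms by (auto simp: vecs_def)
  then show ?thesis
    by (induction x y arbitrary: k rule: list_induct2) (auto simp: vzero_def)
qed

lemma vadd_vzero:
  assumes "x \<in> vecs k" shows "vadd x (vzero k) = x"
proof -
  have "length x = k" using assms by (simp add: vecs_def)
  then show ?thesis by (induction x arbitrary: k) (auto simp: vzero_def)
qed

text \<open>The character with value -1 exactly when the inner product of \<open>a\<close> and
  \<open>x\<close> over F_2 is 1. The recursion matches the splitting in
  \<open>sum_vecs_Suc\<close>.\<close>

fun chi :: "bool list \<Rightarrow> bool list \<Rightarrow> real" where
  "chi (p # a) (q # x) = (if p \<and> q then - 1 else 1) * chi a x"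
| "chi _ _ = 1"

lemma chi_commute: "chi a x = chi x a"
  by (induction a x rule: chi.induct) auto

lemma chi_cases: "chi a x = 1 \<or> chi a x = - 1"
  by (induction a x rule: chi.induct) auto

lemma chi_vadd_right:
  assumes "a \<in> vecs k" "x \<in> vecs k" "y \<in> vecs k"
  shows "chi a (vadd x y) = chi a x * chi a y"
proof -
  have "length a = length x" "length x = length y" using assms by (auto simp: vecs_def)
  then show ?thesis by (induction a x y rule: list_induct3) auto
qed

lemma chi_vadd_left:
  assumes "a \<in> vecs k" "b \<in> vecs k" "x \<in> vecs k"
  shows "chi (vadd a b) x = chi a x * chi b x"
  using chi_vadd_right[OF assms(3,1,2)] by (simp add: chi_commute)

text \<open>Orthogonality of characters: on splitting by the first bit of \<open>a\<close>, the two
  halves cancel if the first bit of \<open>x\<close> is set and coincide otherwise.\<close>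

lemma sum_chi:
  assumes "x \<in> vecs k"
  shows "(\<Sum>a\<in>vecs k. chi a x) = (if x = vzero k then 2 ^ k else 0)"
  using assms
proof (induction k arbitrary: x)
  case 0
  then show ?case by (simp add: vecs_def vzero_def)
next
  case (Suc k)
  then obtain q y where x: "x = q # y" "y \<in> vecs k" by (auto simp: vecs_def length_Suc_conv)
  show ?case using Suc.IH[OF x(2)]
    by (auto simp: x(1) sum_vecs_Suc sum_negf vzero_def)
qed

lemma chi_vzero: "chi a (vzero k) = 1"
  unfolding vzero_def
proof (induction k arbitrary: a)
  case (Suc k)
  then show ?case by (cases a) auto
qed simp

text \<open>If all characters were 1 at \<open>x\<close>, their sum would contradict orthogonality.
  This places every nonzero generator in some codeword.\<close>

lemma exists_chi_neg:
  assumes "x \<in> vecs k" "x \<noteq> vzero k"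
  shows "\<exists>a\<in>vecs k. chi a x = - 1"
proof (rule ccontr)
  assume "\<not> ?thesis"
  then have "chi a x = 1" if "a \<in> vecs k" for a using chi_cases that by blast
  then have "(\<Sum>a\<in>vecs k. chi a x) = 2 ^ k" by (simp add: card_vecs)
  then show False using sum_chi[OF assms(1)] assms(2) by simp
qed

text \<open>Left unnormalised, whence the factors \<open>2 ^ k\<close> below.\<close>

definition fourier :: "nat \<Rightarrow> (bool list \<Rightarrow> real) \<Rightarrow> bool list \<Rightarrow> real" where
  "fourier k f a = (\<Sum>x\<in>vecs k. f x * chi a x)"

text \<open>After expanding the square, the three characters merge into one at
  \<open>x + g + y\<close>, and summing over \<open>a\<close> leaves only
  \<open>y = x + g\<close>.\<close>

lemma fourier_correlation:
  assumes g: "g \<in> vecs k"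
  shows "(\<Sum>a\<in>vecs k. (fourier k f a)\<^sup>2 * chi a g) = 2 ^ k * (\<Sum>x\<in>vecs k. f x * f (vadd x g))"
proof -
  have "(\<Sum>a\<in>vecs k. (fourier k f a)\<^sup>2 * chi a g) =
      (\<Sum>a\<in>vecs k. \<Sum>x\<in>vecs k. \<Sum>y\<in>vecs k. f x * f y * chi a (vadd (vadd x g) y))"
  proof (rule sum.cong[OF refl])
    fix a assume a: "a \<in> vecs k"
    have "(fourier k f a)\<^sup>2 * chi a g =
        (\<Sum>x\<in>vecs k. \<Sum>y\<in>vecs k. (f x * chi a x) * (f y * chi a y) * chi a g)"
      unfolding fourier_def power2_eq_square sum_product by (simp only: sum_distrib_right)
    also have "\<dots> = (\<Sum>x\<in>vecs k. \<Sum>y\<in>vecs k. f x * f y * chi a (vadd (vadd x g) y))"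
      using a g by (intro sum.cong refl) (simp add: chi_vadd_right[of a k] vadd_closed)
    finally show "(fourier k f a)\<^sup>2 * chi a g = \<dots>" .
  qed
  also have "\<dots> = (\<Sum>x\<in>vecs k. \<Sum>a\<in>vecs k. \<Sum>y\<in>vecs k. f x * f y * chi a (vadd (vadd x g) y))"
    by (rule sum.swap)
  also have "\<dots> = (\<Sum>x\<in>vecs k. \<Sum>y\<in>vecs k. \<Sum>a\<in>vecs k. f x * f y * chi a (vadd (vadd x g) y))"
    by (rule sum.cong[OF refl], rule sum.swap)
  also have "\<dots> = (\<Sum>x\<in>vecs k. 2 ^ k * (f x * f (vadd x g)))"
  proof (rule sum.cong[OF refl])
    fix x assume x: "x \<in> vecs k"
    have "(\<Sum>y\<in>vecs k. \<Sum>a\<in>vecs k. f x * f y * chi a (vadd (vadd x g) y)) =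
        (\<Sum>y\<in>vecs k. if vadd x g = y then 2 ^ k * (f x * f (vadd x g)) else 0)"
    proof (rule sum.cong[OF refl])
      fix y assume y: "y \<in> vecs k"
      have xg: "vadd x g \<in> vecs k" using x g by (rule vadd_closed)
      show "(\<Sum>a\<in>vecs k. f x * f y * chi a (vadd (vadd x g) y)) =
          (if vadd x g = y then 2 ^ k * (f x * f (vadd x g)) else 0)"
        unfolding sum_distrib_left[symmetric] sum_chi[OF vadd_closed[OF xg y]]
          vadd_eq_vzero_iff[OF xg y] by auto
    qed
    also have "\<dots> = 2 ^ k * (f x * f (vadd x g))"
      using vadd_closed[OF x g] finite_vecs by simp
    finally show "(\<Sum>y\<in>vecs k. \<Sum>a\<in>vecs k. f x * f y * chi a (vadd (vadd x g) y)) =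
      2 ^ k * (f x * f (vadd x g))" .
  qed
  finally show ?thesis by (simp add: sum_distrib_left)
qed

lemma parseval: "(\<Sum>a\<in>vecs k. (fourier k f a)\<^sup>2) = 2 ^ k * (\<Sum>x\<in>vecs k. (f x)\<^sup>2)"
proof -
  have z: "vzero k \<in> vecs k" by (simp add: vecs_def vzero_def)
  show ?thesis
    using fourier_correlation[OF z, of f] by (simp add: chi_vzero vadd_vzero power2_eq_square)
qed

section \<open>Cayley Laplacians in the basis of characters\<close>

text \<open>The support of the codeword that \<open>a\<close> produces from the generator matrix
  with columns \<open>\<Gamma>\<close>.\<close>

definition codeword :: "bool list set \<Rightarrow> bool list \<Rightarrow> bool list set" where
  "codeword \<Gamma> a = {g \<in> \<Gamma>. chi a g = - 1}"

lemma sum_cayley_adj: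
  assumes \<Gamma>: "\<Gamma> \<subseteq> vecs k" and x: "x \<in> vecs k"
  shows "(\<Sum>y\<in>vecs k. cayley_adj \<Gamma> w x y * h y) = (\<Sum>g\<in>\<Gamma>. w g * h (vadd x g))"
proof -
  have fin: "finite \<Gamma>" using \<Gamma> finite_vecs finite_subset by blast
  have "(\<Sum>y\<in>vecs k. cayley_adj \<Gamma> w x y * h y) =
      (\<Sum>y\<in>vecs k. \<Sum>g\<in>\<Gamma>. if vadd x g = y then w g * h y else 0)"
    unfolding cayley_adj_def using fin
    by (intro sum.cong refl) (auto simp: sum_distrib_right sum.inter_filter[symmetric] intro!: sum.cong)
  also have "\<dots> = (\<Sum>g\<in>\<Gamma>. \<Sum>y\<in>vecs k. if vadd x g = y then w g * h y else 0)"
    by (rule sum.swap)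
  also have "\<dots> = (\<Sum>g\<in>\<Gamma>. w g * h (vadd x g))"
    using \<Gamma> x finite_vecs vadd_closed by (intro sum.cong refl) auto
  finally show ?thesis .
qed

text \<open>The eigenvalue at \<open>a\<close> is the sum of \<open>w g * (1 - chi a g)\<close>,
  where the bracket is 2 on the codeword of \<open>a\<close> and 0 elsewhere.\<close>

lemma cayley_quadratic_form:
  assumes \<Gamma>: "\<Gamma> \<subseteq> vecs k"
  shows "2 ^ k * (\<Sum>x\<in>vecs k. \<Sum>y\<in>vecs k. f x * cayley_laplacian k \<Gamma> w x y * f y) =
    (\<Sum>a\<in>vecs k. (fourier k f a)\<^sup>2 * (2 * sum w (codeword \<Gamma> a)))"
proof -
  have fin: "finite \<Gamma>" using \<Gamma> finite_vecs finite_subset by blast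
  have row: "(\<Sum>y\<in>vecs k. f x * cayley_laplacian k \<Gamma> w x y * f y) =
      (\<Sum>g\<in>\<Gamma>. w g * ((f x)\<^sup>2 - f x * f (vadd x g)))" if x: "x \<in> vecs k" for x
  proof -
    have deg: "cayley_deg k \<Gamma> w x = sum w \<Gamma>"
      using sum_cayley_adj[OF \<Gamma> x, of w "\<lambda>_. 1"] by (simp add: cayley_deg_def)
    have "(\<Sum>y\<in>vecs k. f x * cayley_laplacian k \<Gamma> w x y * f y) =
        (\<Sum>y\<in>vecs k. (if x = y then sum w \<Gamma> * (f x)\<^sup>2 else 0) - f x * (cayley_adj \<Gamma> w x y * f y))"
      by (intro sum.cong) (auto simp: cayley_laplacian_def deg algebra_simps power2_eq_square)
    also have "\<dots> = sum w \<Gamma> * (f x)\<^sup>2 - f x * (\<Sum>g\<in>\<Gamma>. w g * f (vadd x g))"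
      using x finite_vecs
      by (simp add: sum_subtractf sum_distrib_left[symmetric] sum_cayley_adj[OF \<Gamma> x])
    finally show ?thesis
      by (simp add: right_diff_distrib sum_subtractf sum_distrib_left sum_distrib_right mult_ac)
  qed
  have "2 ^ k * (\<Sum>x\<in>vecs k. \<Sum>y\<in>vecs k. f x * cayley_laplacian k \<Gamma> w x y * f y) =
      2 ^ k * (\<Sum>x\<in>vecs k. \<Sum>g\<in>\<Gamma>. w g * ((f x)\<^sup>2 - f x * f (vadd x g)))"
    using row by simp
  also have "\<dots> = (\<Sum>g\<in>\<Gamma>. w g * (2 ^ k * (\<Sum>x\<in>vecs k. (f x)\<^sup>2) - 2 ^ k * (\<Sum>x\<in>vecs k. f x * f (vadd x g))))"
    by (subst sum.swap) (simp add: sum_distrib_left right_diff_distrib sum_subtractf mult_ac)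
  also have "\<dots> = (\<Sum>g\<in>\<Gamma>. \<Sum>a\<in>vecs k. w g * ((fourier k f a)\<^sup>2 * (1 - chi a g)))"
  proof (rule sum.cong[OF refl])
    fix g assume "g \<in> \<Gamma>"
    then have g: "g \<in> vecs k" using \<Gamma> by blast
    show "w g * (2 ^ k * (\<Sum>x\<in>vecs k. (f x)\<^sup>2) - 2 ^ k * (\<Sum>x\<in>vecs k. f x * f (vadd x g))) =
        (\<Sum>a\<in>vecs k. w g * ((fourier k f a)\<^sup>2 * (1 - chi a g)))"
      unfolding parseval[symmetric] fourier_correlation[OF g, symmetric]
      by (simp add: sum_distrib_left right_diff_distrib sum_subtractf)
  qed
  also have "\<dots> = (\<Sum>a\<in>vecs k. \<Sum>g\<in>\<Gamma>. w g * ((fourier k f a)\<^sup>2 * (1 - chi a g)))"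
    by (rule sum.swap)
  also have "\<dots> = (\<Sum>a\<in>vecs k. (fourier k f a)\<^sup>2 * (2 * sum w (codeword \<Gamma> a)))"
  proof (rule sum.cong[OF refl])
    fix a
    have "(\<Sum>g\<in>\<Gamma>. w g * ((fourier k f a)\<^sup>2 * (1 - chi a g))) =
        (\<Sum>g\<in>\<Gamma>. if chi a g = - 1 then (fourier k f a)\<^sup>2 * (2 * w g) else 0)"
      using chi_cases[of a] by (intro sum.cong) auto
    also have "\<dots> = (\<Sum>g\<in>codeword \<Gamma> a. (fourier k f a)\<^sup>2 * (2 * w g))"
      unfolding codeword_def using fin by (rule sum.inter_filter[symmetric])
    finally show "(\<Sum>g\<in>\<Gamma>. w g * ((fourier k f a)\<^sup>2 * (1 - chi a g))) =
        (fourier k f a)\<^sup>2 * (2 * sum w (codeword \<Gamma> a))"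
      by (simp add: sum_distrib_left)
  qed
  finally show ?thesis .
qed

lemma cayley_laplacian_sym:
  assumes "\<Gamma> \<subseteq> vecs k" "x \<in> vecs k" "y \<in> vecs k"
  shows "cayley_laplacian k \<Gamma> w x y = cayley_laplacian k \<Gamma> w y x"
proof -
  have "{g \<in> \<Gamma>. vadd x g = y} = {g \<in> \<Gamma>. vadd y g = x}"
    using assms vadd_eq_iff by blast
  then show ?thesis by (simp add: cayley_laplacian_def cayley_adj_def)
qed

text \<open>All Cayley Laplacians on the same group are diagonal in the characters, so they can be
  compared eigenvalue by eigenvalue. Scalars on both sides let one statement serve both halves of
  the sandwich.\<close>

lemma loewner_le_cayley:
  assumes \<Gamma>: "\<Gamma> \<subseteq> vecs k" "\<Gamma>' \<subseteq> vecs k"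
    and le: "\<And>a. a \<in> vecs k \<Longrightarrow> \<alpha> * sum w (codeword \<Gamma> a) \<le> \<beta> * sum w' (codeword \<Gamma>' a)"
  shows "loewner_le k (\<lambda>x y. \<alpha> * cayley_laplacian k \<Gamma> w x y) (\<lambda>x y. \<beta> * cayley_laplacian k \<Gamma>' w' x y)"
  unfolding loewner_le_def psd_on_def
proof (intro conjI ballI allI)
  fix x y assume "x \<in> vecs k" "y \<in> vecs k"
  then show "\<beta> * cayley_laplacian k \<Gamma>' w' x y - \<alpha> * cayley_laplacian k \<Gamma> w x y =
      \<beta> * cayley_laplacian k \<Gamma>' w' y x - \<alpha> * cayley_laplacian k \<Gamma> w y x"
    using \<Gamma> cayley_laplacian_sym by metis
next
  fix f :: "bool list \<Rightarrow> real"
  let ?Q = "\<lambda>\<Gamma> w. \<Sum>x\<in>vecs k. \<Sum>y\<in>vecs k. f x * cayley_laplacian k \<Gamma> w x y * f y"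
  let ?S = "\<Sum>x\<in>vecs k. \<Sum>y\<in>vecs k.
    f x * (\<beta> * cayley_laplacian k \<Gamma>' w' x y - \<alpha> * cayley_laplacian k \<Gamma> w x y) * f y"
  have lin: "\<beta> * (\<Sum>a\<in>A. p a) - \<alpha> * (\<Sum>a\<in>A. q a) = (\<Sum>a\<in>A. \<beta> * p a - \<alpha> * q a)"
    for p q and A :: "bool list set"
    by (simp add: sum_subtractf sum_distrib_left)
  have "?S = \<beta> * ?Q \<Gamma>' w' - \<alpha> * ?Q \<Gamma> w"
    unfolding lin by (intro sum.cong refl) (simp add: algebra_simps)
  then have "2 ^ k * ?S = \<beta> * (2 ^ k * ?Q \<Gamma>' w') - \<alpha> * (2 ^ k * ?Q \<Gamma> w)"
    by (simp only: right_diff_distrib mult.left_commute[of "2 ^ k"])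
  also have "\<dots> = (\<Sum>a\<in>vecs k. \<beta> * ((fourier k f a)\<^sup>2 * (2 * sum w' (codeword \<Gamma>' a))) -
      \<alpha> * ((fourier k f a)\<^sup>2 * (2 * sum w (codeword \<Gamma> a))))"
    unfolding cayley_quadratic_form[OF \<Gamma>(1)] cayley_quadratic_form[OF \<Gamma>(2)] by (rule lin)
  also have "\<dots> \<ge> 0"
  proof (rule sum_nonneg)
    fix a assume "a \<in> vecs k"
    then have "0 \<le> 2 * (fourier k f a)\<^sup>2 *
        (\<beta> * sum w' (codeword \<Gamma>' a) - \<alpha> * sum w (codeword \<Gamma> a))"
      using le by (intro mult_nonneg_nonneg) auto
    then show "0 \<le> \<beta> * ((fourier k f a)\<^sup>2 * (2 * sum w' (codeword \<Gamma>' a))) -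
        \<alpha> * ((fourier k f a)\<^sup>2 * (2 * sum w (codeword \<Gamma> a)))"
      by (simp add: algebra_simps)
  qed
  finally have "2 ^ k * 0 \<le> 2 ^ k * ?S" by (simp only: mult_zero_right)
  then show "0 \<le> ?S" by (rule mult_left_le_imp_le) simp
qed

section \<open>From code sparsifiers to Cayley sparsifiers\<close>

lemma sym_diff_codeword:
  assumes "\<Gamma> \<subseteq> vecs k" "a \<in> vecs k" "b \<in> vecs k"
  shows "sym_diff (codeword \<Gamma> a) (codeword \<Gamma> b) = codeword \<Gamma> (vadd a b)"
proof -
  have "g \<in> sym_diff (codeword \<Gamma> a) (codeword \<Gamma> b) \<longleftrightarrow> g \<in> codeword \<Gamma> (vadd a b)" for g
  proof (cases "g \<in> \<Gamma>")
    case True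
    then have "chi (vadd a b) g = chi a g * chi b g"
      using chi_vadd_left[OF assms(2,3)] assms(1) by blast
    then show ?thesis
      using chi_cases[of a g] chi_cases[of b g] True by (auto simp: codeword_def)
  qed (simp add: codeword_def)
  then show ?thesis by blast
qed

lemma binary_code_codewords:
  assumes "\<Gamma> \<subseteq> vecs k"
  shows "binary_code \<Gamma> (codeword \<Gamma> ` vecs k)"
proof
  show "finite \<Gamma>" using assms finite_vecs finite_subset by blast
  show "c \<subseteq> \<Gamma>" if "c \<in> codeword \<Gamma> ` vecs k" for c using that by (auto simp: codeword_def)
  have "codeword \<Gamma> (vzero k) = {}" by (simp add: codeword_def chi_commute[of "vzero k"] chi_vzero)
  moreover have "vzero k \<in> vecs k" by (simp add: vecs_def vzero_def)
  ultimately show "{} \<in> codeword \<Gamma> ` vecs k" by (metis image_eqI)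
  show "sym_diff c d \<in> codeword \<Gamma> ` vecs k"
    if "c \<in> codeword \<Gamma> ` vecs k" "d \<in> codeword \<Gamma> ` vecs k" for c d
    using that sym_diff_codeword[OF assms] vadd_closed by auto
qed

text \<open>Passing from \<open>ln\<close> to \<open>log 2\<close> and dividing the argument by
  \<open>\<epsilon>\<close> only enlarge the logarithm. The additive 1 is absorbed because both
  \<open>k / \<epsilon>^2\<close> and the logarithm are at least 1, which turns 16 into 17.\<close>

lemma size_estimate:
  fixes \<epsilon> :: real
  assumes k: "1 \<le> k" and eps: "0 < \<epsilon>" "\<epsilon> < 1"
  shows "16 * real k * ln (4 * real k) / \<epsilon>\<^sup>2 + 1 \<le> 17 * real k / \<epsilon>\<^sup>2 * log 2 (4 * real k / \<epsilon>)"
proof -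
  define L where "L = log 2 (4 * real k / \<epsilon>)"
  define q where "q = real k / \<epsilon>\<^sup>2"
  have kr: "1 \<le> real k" using k by simp
  have le: "4 * real k \<le> 4 * real k / \<epsilon>" using kr eps by (simp add: field_simps)
  have "2 powr 1 \<le> 4 * real k / \<epsilon>" using le kr by simp
  then have L1: "1 \<le> L" unfolding L_def using kr eps by (subst le_log_iff) auto
  have "ln (4 * real k) \<le> ln (4 * real k / \<epsilon>)" using le kr eps by (subst ln_le_cancel_iff) auto
  also have "\<dots> = L * ln 2" by (simp add: L_def log_def)
  also have "\<dots> \<le> L" using L1 ln_2_less_1 by (simp add: mult_left_le)
  finally have "16 * q * ln (4 * real k) \<le> 16 * q * L"
    by (intro mult_left_mono) (auto simp: q_def)
  moreover have "\<epsilon>\<^sup>2 \<le> 1" using eps by (simp add: power_le_one)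
  then have "1 \<le> q" using kr eps by (simp add: q_def field_simps)
  then have "1 * 1 \<le> q * L" using L1 by (intro mult_mono) auto
  ultimately have "16 * q * ln (4 * real k) + 1 \<le> 17 * q * L" by simp
  then show ?thesis by (simp add: q_def L_def)
qed

theorem theorem1p4:
  shows "\<exists>C c :: real. C > 0 \<and> c > 0 \<and>
    (\<forall>(k::nat) (\<epsilon>::real) (\<Gamma>::bool list set) (w::bool list \<Rightarrow> real).
       k \<ge> 1 \<longrightarrow> 0 < \<epsilon> \<longrightarrow> \<epsilon> < 1 \<longrightarrow> generating_set k \<Gamma> \<longrightarrow> (\<forall>g\<in>\<Gamma>. w g > 0) \<longrightarrow>
       (\<exists>\<Gamma>' (w'::bool list \<Rightarrow> real). \<Gamma>' \<subseteq> \<Gamma> \<and>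
          real (card \<Gamma>') \<le> C * real k / \<epsilon>\<^sup>2 * (log 2 (4 * real k / \<epsilon>)) powr c \<and>
          (\<forall>g\<in>\<Gamma>'. w' g > 0) \<and>
          loewner_le k (\<lambda>x y. (1 - \<epsilon>) * cayley_laplacian k \<Gamma> w x y) (cayley_laplacian k \<Gamma>' w') \<and>
          loewner_le k (cayley_laplacian k \<Gamma>' w') (\<lambda>x y. (1 + \<epsilon>) * cayley_laplacian k \<Gamma> w x y)))"
proof (rule exI[of _ 17], rule exI[of _ 1], intro conjI allI impI)
  fix k :: nat and \<epsilon> :: real and \<Gamma> :: "bool list set" and w :: "bool list \<Rightarrow> real"
  assume k: "1 \<le> k" and eps: "0 < \<epsilon>" "\<epsilon> < 1" and gen: "generating_set k \<Gamma>"
    and w: "\<forall>g\<in>\<Gamma>. 0 < w g"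
  have \<Gamma>: "\<Gamma> \<subseteq> vecs k" using gen by (simp add: generating_set_def)
  \<comment> \<open>The zero vector generates only loops and lies in no codeword. It has to be
    removed for the codewords to cover \<open>E\<close>, and this changes no codeword
    weight.\<close>
  define E where "E = \<Gamma> - {vzero k}"
  define C where "C = codeword E ` vecs k"
  have E: "E \<subseteq> vecs k" using \<Gamma> by (auto simp: E_def)
  interpret binary_code E C unfolding C_def by (rule binary_code_codewords[OF E])
  have wE: "0 < w e" if "e \<in> E" for e using w that by (simp add: E_def)
  have cover: "E \<subseteq> \<Union>C"
    unfolding C_def codeword_def using exists_chi_neg E E_def by fastforce
  have card_C: "card C \<le> 2 ^ k"
    unfolding C_def using card_image_le[OF finite_vecs] by (metis card_vecs)
  obtain X w' where X: "X \<subseteq> E" and w': "\<And>e. e \<in> X \<Longrightarrow> 0 < w' e"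
    and card_X: "real (card X) \<le> 16 * real k * ln (4 * real k) / \<epsilon>\<^sup>2 + 1"
    and approx: "\<And>c. c \<in> C \<Longrightarrow> \<bar>sum w' (c \<inter> X) - sum w c\<bar> \<le> \<epsilon> * sum w c"
    by (rule code_sparsification[of w k \<epsilon>, OF wE cover card_C k eps(1) less_imp_le[OF eps(2)]]) blast+
  have X_vecs: "X \<subseteq> vecs k" using X E by blast
  have bounds: "\<bar>sum w' (codeword X a) - sum w (codeword \<Gamma> a)\<bar> \<le> \<epsilon> * sum w (codeword \<Gamma> a)"
    if "a \<in> vecs k" for a
  proof -
    have "codeword X a = codeword E a \<inter> X" using X by (auto simp: codeword_def)
    moreover have "codeword \<Gamma> a = codeword E a" by (auto simp: codeword_def E_def chi_vzero)
    ultimately show ?thesis using approx[of "codeword E a"] that by (simp add: C_def)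
  qed
  have "loewner_le k (\<lambda>x y. (1 - \<epsilon>) * cayley_laplacian k \<Gamma> w x y)
      (\<lambda>x y. 1 * cayley_laplacian k X w' x y)"
    using bounds by (intro loewner_le_cayley[OF \<Gamma> X_vecs]) (simp add: abs_le_iff algebra_simps)
  moreover have "loewner_le k (\<lambda>x y. 1 * cayley_laplacian k X w' x y)
      (\<lambda>x y. (1 + \<epsilon>) * cayley_laplacian k \<Gamma> w x y)"
    using bounds by (intro loewner_le_cayley[OF X_vecs \<Gamma>]) (simp add: abs_le_iff algebra_simps)
  \<comment> \<open>Nonnegativity of the logarithm is what allows \<open>powr 1\<close> to be
    dropped.\<close>
  moreover have "1 \<le> log 2 (4 * real k / \<epsilon>)"
  proof -
    have "2 * \<epsilon> \<le> 4 * real k" using k eps by simp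
    then show ?thesis using k eps by (subst le_log_iff) (auto simp: field_simps)
  qed
  then have "real (card X) \<le> 17 * real k / \<epsilon>\<^sup>2 * log 2 (4 * real k / \<epsilon>) powr 1"
    using card_X size_estimate[OF k eps] by simp
  moreover have "X \<subseteq> \<Gamma>" using X by (auto simp: E_def)
  ultimately show "\<exists>\<Gamma>' w'. \<Gamma>' \<subseteq> \<Gamma> \<and>
      real (card \<Gamma>') \<le> 17 * real k / \<epsilon>\<^sup>2 * log 2 (4 * real k / \<epsilon>) powr 1 \<and>
      (\<forall>g\<in>\<Gamma>'. 0 < w' g) \<and>
      loewner_le k (\<lambda>x y. (1 - \<epsilon>) * cayley_laplacian k \<Gamma> w x y) (cayley_laplacian k \<Gamma>' w') \<and>
      loewner_le k (cayley_laplacian k \<Gamma>' w') (\<lambda>x y. (1 + \<epsilon>) * cayley_laplacian k \<Gamma> w x y)"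
    using w' by (intro exI[of _ X] exI[of _ w']) simp
qed simp_all

end
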